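(* Let $S=(r;m_2,m_3,\ldots,m_l)$ be a tree eccentric sequence. Then, among all trees $T$ whose eccentric sequence is $S$, the tree $\mathbf{T}(r;m_2,\ldots,m_l)$ uniquely (up to isomorphism) minimises each of the following: the Wiener index $W(T)$, the hyper-Wiener index $WW(T)$, the generalised Wiener index $W^{\lambda}(T)$ for every real $\lambda>0$, and the reciprocal complementary Wiener index $RCW(T)$.
   Context: Graphs are finite and simple; $d(u,v)$ is the usual graph distance. The eccentricity of a vertex $v$ is $\max_u d(v,u)$. The eccentric sequence of a connected graph is the nondecreasing sequence of the eccentricities of its vertices. A tree eccentric sequence is a sequence that is the eccentric sequence of some tree; only trees with $n>2$ vertices are considered. For a tree, let $b_1<b_2<\cdots<b_l$ be the distinct eccentricities of its vertices and let $m_j$ be the number of vertices of eccentricity $b_j$. The $b_j$ are consecutive integers, $m_1\in\{1,2\}$, and the eccentric sequence is completely determined by $b_1,m_2,\ldots,m_l$; it is written $S=(b_1;m_2,m_3,\ldots,m_l)$. A tree with eccentric sequence $(r;m_2,\ldots,m_l)$ has radius $r$, diameter $r+l-1$, and exactly $m_j$ vertices of eccentricity $r+j-1$ for $2\le j\le l$. For integers $b_1>0$ and $m_2,\ldots,m_l>1$, $\mathbf{T}(b_1;m_2,\ldots,m_l)$ is the tree obtained from the path $v_0,v_1,\ldots,v_{b_1+l-1}$ by attaching $m_j-2$ pendent edges to the vertex $v_{l+1-j}$ for all $2\le j\le l$. With sums over all unordered pairs $\{u,v\}$ of distinct vertices of a connected graph $G$: $W(G)=\sum d(u,v)$; $WW(G)=\sum\binom{1+d(u,v)}{2}$;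 $W^{\lambda}(G)=\sum d(u,v)^{\lambda}$; $RCW(G)=\sum\frac{1}{d+1-d(u,v)}$, where $d$ is the diameter of $G$. *)

theory Defs
  imports "Graph_Theory.Graph_Theory" "HOL-Library.Multiset"
begin

text \<open>
  A finite simple graph is a \<^const>\<open>pair_graph\<close>: its arc set is a finite, symmetric, irreflexive
  relation, and each undirected edge appears as two opposite arcs.
\<close>

text \<open>
  The library predicate \<^const>\<open>tree\<close> is not usable for undirected graphs, since it counts
  an edge traversed back and forth as a cycle of length 2. All longer cycles in the sense of
  \<^const>\<open>pre_digraph.cycle\<close> are cycles of the undirected graph.
\<close>

definition undirected_tree :: "'a pair_pre_digraph \<Rightarrow> bool" where
  "undirected_tree G \<longleftrightarrow> pair_graph G \<and> connected (with_proj G) \<and>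
     \<not> (\<exists>p. pre_digraph.cycle (with_proj G) p \<and> 3 \<le> length p)"

definition isomorphic :: "'a pair_pre_digraph \<Rightarrow> 'b pair_pre_digraph \<Rightarrow> bool" where
  "isomorphic G H \<longleftrightarrow> digraph_iso (with_proj G) (with_proj H)"

definition gdist :: "'a pair_pre_digraph \<Rightarrow> 'a \<Rightarrow> 'a \<Rightarrow> nat" where
  "gdist G u v = (INF p \<in> {p. pre_digraph.awalk (with_proj G) u p v}. length p)"

lemma (in pair_graph) gdist_commute: "gdist G u v = gdist G v u"
proof -
  have "length ` {p. awalk u p v} \<subseteq> length ` {p. awalk v p u}" for u v
  proof
    fix n assume "n \<in> length ` {p. awalk u p v}"
    then obtain p where "awalk u p v" "n = length p" by auto
    then have "awalk v (rev_path p) u" by simp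
    moreover have "length (rev_path p) = n" unfolding \<open>n = length p\<close> by (induct p) auto
    ultimately have "awalk v (rev_path p) u" "n = length (rev_path p)" by simp_all
    then show "n \<in> length ` {p. awalk v p u}" by blast
  qed
  then have "length ` {p. awalk u p v} = length ` {p. awalk v p u}" by blast
  then show ?thesis by (simp add: gdist_def)
qed

definition eccentricity :: "'a pair_pre_digraph \<Rightarrow> 'a \<Rightarrow> nat" where
  "eccentricity G v = Max (gdist G v ` pverts G)"

definition graph_diameter :: "'a pair_pre_digraph \<Rightarrow> nat" where
  "graph_diameter G = Max {gdist G u v | u v. u \<in> pverts G \<and> v \<in> pverts G}"

definition eccentric_sequence :: "'a pair_pre_digraph \<Rightarrow> nat list" where
  "eccentric_sequence G =
     sorted_list_of_multiset (image_mset (eccentricity G) (mset_set (pverts G)))"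

text \<open>Every finite graph has a copy on natural numbers, so the vertex type is no restriction here.\<close>

definition tree_eccentric_sequence :: "nat list \<Rightarrow> bool" where
  "tree_eccentric_sequence S \<longleftrightarrow>
     (\<exists>G :: nat pair_pre_digraph. undirected_tree G \<and> 2 < card (pverts G) \<and> eccentric_sequence G = S)"

text \<open>
  The short form \<open>(b\<^sub>1; m\<^sub>2, \<dots>, m\<^sub>l)\<close> of a sequence with distinct entries \<open>b\<^sub>1 < \<dots> < b\<^sub>l\<close>, where
  \<open>m\<^sub>j\<close> is the multiplicity of \<open>b\<^sub>j\<close>. The multiplicity \<open>m\<^sub>1\<close> is dropped, so the list
  of multiplicities starts with \<open>m\<^sub>2\<close> at index 0.
\<close>

definition short_form :: "nat list \<Rightarrow> nat \<times> nat list" where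
  "short_form S = (let bs = sorted_list_of_set (set S) in (hd bs, map (count_list S) (tl bs)))"

text \<open>
  In \<open>extremal_tree b ms\<close> the path is \<open>v\<^sub>k = Path k\<close>, and \<open>Pendent j i\<close> is the
  \<open>i\<close>-th of the \<open>m\<^sub>j - 2\<close> leaves attached to \<open>v\<^bsub>l+1-j\<^esub>\<close>. It is meant for \<open>b > 0\<close> and
  all \<open>m\<^sub>j > 1\<close>, so the subtractions do not truncate.
\<close>

datatype extremal_vertex = Path nat | Pendent nat nat

definition extremal_tree :: "nat \<Rightarrow> nat list \<Rightarrow> extremal_vertex pair_pre_digraph" where
  "extremal_tree b ms =
    (let l = length ms + 1;
         m = (\<lambda>j. ms ! (j - 2));
         E = {(Path k, Path (k + 1)) | k. k < b + l - 1} \<union>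
             {(Path (l + 1 - j), Pendent j i) | j i. 2 \<le> j \<and> j \<le> l \<and> i < m j - 2}
     in \<lparr> pverts = {Path k | k. k \<le> b + l - 1} \<union>
                   {Pendent j i | j i. 2 \<le> j \<and> j \<le> l \<and> i < m j - 2},
          parcs = E \<union> E\<inverse> \<rparr>)"

definition vertex_pairs :: "'a pair_pre_digraph \<Rightarrow> 'a set set" where
  "vertex_pairs G = {e. e \<subseteq> pverts G \<and> card e = 2}"

definition pair_dist :: "'a pair_pre_digraph \<Rightarrow> 'a set \<Rightarrow> nat" where
  "pair_dist G e = (THE d. \<exists>u v. e = {u, v} \<and> d = gdist G u v)"

lemma (in pair_graph) pair_dist_eq: "pair_dist G {u, v} = gdist G u v"
  unfolding pair_dist_def
  by (rule the_equality) (auto simp: doubleton_eq_iff gdist_commute)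

definition wiener :: "'a pair_pre_digraph \<Rightarrow> nat" where
  "wiener G = (\<Sum>e\<in>vertex_pairs G. pair_dist G e)"

definition hyper_wiener :: "'a pair_pre_digraph \<Rightarrow> nat" where
  "hyper_wiener G = (\<Sum>e\<in>vertex_pairs G. (1 + pair_dist G e) choose 2)"

definition generalised_wiener :: "real \<Rightarrow> 'a pair_pre_digraph \<Rightarrow> real" where
  "generalised_wiener a G = (\<Sum>e\<in>vertex_pairs G. real (pair_dist G e) powr a)"

definition reciprocal_complementary_wiener :: "'a pair_pre_digraph \<Rightarrow> real" where
  "reciprocal_complementary_wiener G =
     (\<Sum>e\<in>vertex_pairs G. 1 / (real (graph_diameter G) + 1 - real (pair_dist G e)))"

end

theory Submission
  imports Defs
begin

text \<open>
  Let \<open>D\<close> be the diameter of a tree. A vertex of eccentricity \<open>p\<close> has distance \<open>p - D / 2\<close> from the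
  midpoint of the longest paths, so the eccentric sequence says how many vertices lie at each level
  above this midpoint. The midpoint is a vertex or the middle of an edge, and its removal splits the
  tree into branches. All four indices are sums \<open>\<Sum> f (d(u,v))\<close> with \<open>f\<close> strictly increasing on the
  distances that occur, and the sum can be bounded separately for each pair of levels \<open>p \<le> q\<close>, of
  sizes \<open>n\<close> and \<open>m\<close>, that do not consist of a central vertex:

  \<^item> Every vertex at level \<open>q\<close> has exactly one ancestor at level \<open>p\<close>, at distance \<open>q - p\<close>. This gives
    \<open>m\<close> pairs.
  \<^item> Two vertices in different branches have distance \<open>p + q - D\<close>, the greatest possible one. Since
    two branches contain an end of a longest path, and hence reach every level, at least
    \<open>n + m - 2\<close> pairs are of this kind.
  \<^item> For the other pairs the distance exceeds \<open>q - p\<close>, and by parity it is at least \<open>q - p + 2\<close>.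

  The resulting lower bound (\<open>pair_sum_ge_bound\<close>) depends on the eccentric sequence only, and the
  extremal tree attains it (\<open>pair_sum_E_le\<close>): one of its branches is a bare path, and in the rest
  all vertices of a level are siblings.

  If a tree attains all the bounds, then its vertices at the same level of a branch are siblings, and
  the vertices outside a suitable longest path, apart from neighbours of a central vertex, belong to
  the branch of one end of this path. So the other vertices are attached to the path exactly where
  the extremal tree has its pendent vertices (\<open>tight_imp_caterpillar\<close>). This yields a bijection
  from the extremal tree that does not increase any distance; as the two sums agree and \<open>f\<close> is
  strictly increasing, it preserves all distances and is an isomorphism (\<open>caterpillar_isomorphic\<close>).

  The estimates use the distance function alone. What they need to know of a tree is collected in the
  locale \<open>tree_metric\<close>: above all the four-point condition, from which every structural fact
  follows by inserting suitable vertices, mostly ends of longest paths.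
\<close>

section \<open>Tree metrics\<close>

text \<open>
  The four-point condition alone also holds for graphs such as the triangle, whose branching points
  would lie at half-integer positions. The parity of perimeters excludes these.
\<close>

locale tree_metric =
  fixes V :: "'a set" and d :: "'a \<Rightarrow> 'a \<Rightarrow> nat"
  assumes finite_V: "finite V" and V_nonempty: "V \<noteq> {}"
    and d_zero_iff: "x \<in> V \<Longrightarrow> y \<in> V \<Longrightarrow> d x y = 0 \<longleftrightarrow> x = y"
    and d_commute: "x \<in> V \<Longrightarrow> y \<in> V \<Longrightarrow> d x y = d y x"
    and four_point: "x \<in> V \<Longrightarrow> y \<in> V \<Longrightarrow> z \<in> V \<Longrightarrow> w \<in> V \<Longrightarrow>
          d x y + d z w \<le> max (d x z + d y w) (d x w + d y z)"
    and even_perimeter: "x \<in> V \<Longrightarrow> y \<in> V \<Longrightarrow> z \<in> V \<Longrightarrow> even (d x y + d y z + d z x)"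
    and geodesic: "x \<in> V \<Longrightarrow> y \<in> V \<Longrightarrow> k \<le> d x y \<Longrightarrow> \<exists>z\<in>V. d x z = k \<and> d z y = d x y - k"

text \<open>
  The sum of \<open>f\<close> over the distances between a level \<open>p\<close> with \<open>n\<close> vertices and a level \<open>q \<ge> p\<close> with \<open>m\<close>
  vertices, when only \<open>n + m - 2\<close> pairs lie in different branches and all pairs in a common branch that
  are not ancestor and descendant have the least possible distance \<open>q - p + 2\<close>.
\<close>

definition pair_bound :: "nat \<Rightarrow> nat \<Rightarrow> nat \<Rightarrow> nat \<Rightarrow> nat \<Rightarrow> (nat \<Rightarrow> real) \<Rightarrow> real" where
  "pair_bound D p q n m f = real m * f (q - p) + (real n + real m - 2) * f (p + q - D) +
     (real n * real m - real m - (real n + real m - 2)) * f (q - p + 2)"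

context tree_metric
begin

definition ecc :: "'a \<Rightarrow> nat" where
  "ecc x = Max (d x ` V)"

definition diam :: nat where
  "diam = Max (ecc ` V)"

definition level :: "nat \<Rightarrow> 'a set" where
  "level p = {x \<in> V. ecc x = p}"

text \<open>
  The sum \<open>d x y + diam\<close> never exceeds \<open>ecc x + ecc y\<close>, and it is equal to it if and only if the path
  from \<open>x\<close> to \<open>y\<close> runs through the midpoint of the longest paths. If the midpoint is a vertex, it
  shares a branch with no vertex, not even with itself.
\<close>

definition same_branch :: "'a \<Rightarrow> 'a \<Rightarrow> bool" where
  "same_branch x y \<longleftrightarrow> d x y + diam < ecc x + ecc y"

lemma levelD: "x \<in> level p \<Longrightarrow> x \<in> V" "x \<in> level p \<Longrightarrow> ecc x = p"
  by (auto simp: level_def)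

lemma finite_level: "finite (level p)"
  using finite_V by (simp add: level_def)

lemma d_self: "x \<in> V \<Longrightarrow> d x x = 0"
  by (simp add: d_zero_iff)

lemma triangle: "x \<in> V \<Longrightarrow> y \<in> V \<Longrightarrow> z \<in> V \<Longrightarrow> d x z \<le> d x y + d y z"
  using four_point[of x z y y] d_self[of y] d_commute[of y z] by simp

lemma d_le_ecc: "x \<in> V \<Longrightarrow> y \<in> V \<Longrightarrow> d x y \<le> ecc x"
  unfolding ecc_def using finite_V by simp

lemma d_le_ecc': "x \<in> V \<Longrightarrow> y \<in> V \<Longrightarrow> d x y \<le> ecc y"
  using d_le_ecc[of y x] d_commute[of x y] by simp

lemma ecc_le_diam: "x \<in> V \<Longrightarrow> ecc x \<le> diam"
  unfolding diam_def using finite_V by simp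

lemma d_le_diam: "x \<in> V \<Longrightarrow> y \<in> V \<Longrightarrow> d x y \<le> diam"
  using d_le_ecc[of x y] ecc_le_diam[of x] by simp

lemma ecc_attained:
  assumes "x \<in> V"
  obtains y where "y \<in> V" "d x y = ecc x"
proof -
  have "ecc x \<in> d x ` V" unfolding ecc_def using finite_V V_nonempty by (intro Max_in) auto
  then show thesis using that by auto
qed

lemma diam_attained:
  obtains a b where "a \<in> V" "b \<in> V" "d a b = diam"
proof -
  have "diam \<in> ecc ` V" unfolding diam_def using finite_V V_nonempty by (intro Max_in) auto
  then obtain a where a: "a \<in> V" "ecc a = diam" by auto
  moreover obtain b where "b \<in> V" "d a b = ecc a" using ecc_attained a by metis
  ultimately show thesis using that by auto
qed

text \<open>
  The four-point condition for \<open>x\<close>, \<open>y\<close> and the two ends of a longest path.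
\<close>

lemma d_plus_diam_le: 
  assumes "x \<in> V" "y \<in> V"
  shows "d x y + diam \<le> ecc x + ecc y"
proof -
  obtain a b where ab: "a \<in> V" "b \<in> V" "d a b = diam" by (rule diam_attained)
  have "d x y + d a b \<le> max (d x a + d y b) (d x b + d y a)" using four_point assms ab by blast
  moreover have "d x a \<le> ecc x" "d x b \<le> ecc x" "d y a \<le> ecc y" "d y b \<le> ecc y"
    using d_le_ecc assms ab by blast+
  ultimately show ?thesis using ab by linarith
qed

lemma diam_le_twice_ecc: "x \<in> V \<Longrightarrow> diam \<le> 2 * ecc x"
  using d_plus_diam_le[of x x] d_self[of x] by simp

lemma ecc_lipschitz: 
  assumes "x \<in> V" "y \<in> V"
  shows "ecc y \<le> d x y + ecc x"
proof -
  obtain z where z: "z \<in> V" "d y z = ecc y" using ecc_attained assms by metis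
  then show ?thesis
    using triangle[of y x z] d_le_ecc[of x z] d_commute[of x y] assms by simp
qed

lemma same_branch_sym: "x \<in> V \<Longrightarrow> y \<in> V \<Longrightarrow> same_branch x y \<Longrightarrow> same_branch y x"
  using d_commute[of x y] by (simp add: same_branch_def)

lemma not_same_branch_iff: "x \<in> V \<Longrightarrow> y \<in> V \<Longrightarrow> \<not> same_branch x y \<longleftrightarrow> d x y + diam = ecc x + ecc y"
  using d_plus_diam_le[of x y] by (auto simp: same_branch_def)

text \<open>
  If the path from \<open>x\<close> to \<open>z\<close> ran through the midpoint, the four-point condition for \<open>x\<close>, \<open>z\<close>, \<open>y\<close> and
  a vertex farthest from \<open>y\<close> would fail.
\<close>

lemma same_branch_trans:
  assumes V: "x \<in> V" "y \<in> V" "z \<in> V" and xy: "same_branch x y" and yz: "same_branch y z"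
  shows "same_branch x z"
proof (rule ccontr)
  assume "\<not> same_branch x z"
  then have xz: "d x z + diam = ecc x + ecc z" using not_same_branch_iff V by simp
  obtain a where a: "a \<in> V" "d y a = ecc y" using ecc_attained V by metis
  have "d x z + d y a \<le> max (d x y + d z a) (d x a + d z y)" using four_point V a by blast
  moreover have "d z a \<le> ecc z" "d x a \<le> ecc x" "d z y = d y z" using d_le_ecc d_commute V a by blast+
  ultimately show False using xy yz xz a(2) unfolding same_branch_def by linarith
qed

text \<open>
  In a common branch a vertex \<open>a\<close> farthest from \<open>x\<close> is also farthest from \<open>y\<close>, and the perimeter of
  \<open>x\<close>, \<open>y\<close>, \<open>a\<close> is even.
\<close>

lemma same_branch_even:
  assumes V: "x \<in> V" "y \<in> V" and same: "same_branch x y"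
  shows "even (d x y + ecc x + ecc y)"
proof -
  obtain a where a: "a \<in> V" "d x a = ecc x" using ecc_attained V by metis
  obtain b where b: "b \<in> V" "d y b = ecc y" using ecc_attained V by metis
  have "d x a + d y b \<le> max (d x b + d y a) (d x y + d a b)"
    using four_point[of x a b y] d_commute[of y a] d_commute[of y b] d_commute[of a b] V a b
    by (simp add: max.commute)
  moreover have "d x b \<le> ecc x" "d y a \<le> ecc y" "d a b \<le> diam" using d_le_ecc d_le_diam V a b by blast+
  ultimately have "d y a = ecc y" using a b same unfolding same_branch_def by linarith
  then show ?thesis using even_perimeter[of x y a] d_commute[of x a] V a by (simp add: add.commute add.left_commute)
qed

text \<open>
  An eccentricity changes by at most the distance, so \<open>ecc y - ecc x\<close> is the least value that the
  distance can take; parity excludes the next one.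
\<close>

lemma ancestor_or_far:
  assumes V: "x \<in> V" "y \<in> V" and same: "same_branch x y" and le: "ecc x \<le> ecc y"
    and not_anc: "d x y \<noteq> ecc y - ecc x"
  shows "ecc y - ecc x + 2 \<le> d x y"
proof -
  have "ecc y - ecc x < d x y" using ecc_lipschitz[OF V] le not_anc by linarith
  then obtain k where k: "d x y = ecc y - ecc x + k" "k \<noteq> 0" by (metis less_imp_add_positive less_numeral_extra(3))
  have "d x y + ecc x + ecc y = 2 * ecc y + k" using k le by simp
  with same_branch_even[OF V same] have "even (2 * ecc y + k)" by (simp only:)
  then have "even k" by simp
  then have "2 \<le> k" using k(2) by presburger
  then show ?thesis using k by simp
qed

text \<open>
  The ancestor of \<open>y\<close> at level \<open>p\<close> is the vertex at distance \<open>p\<close> from the end on the path from \<open>y\<close> to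
  a vertex farthest from \<open>y\<close>. The assumption \<open>diam \<le> 2 * p\<close> keeps it on the near side of the midpoint.
\<close>

lemma ancestor_exists:
  assumes y: "y \<in> V" and p: "diam \<le> 2 * p" "p \<le> ecc y"
  shows "\<exists>x\<in>level p. d x y = ecc y - p"
proof -
  obtain a where a: "a \<in> V" "d y a = ecc y" using ecc_attained y by metis
  obtain x where x: "x \<in> V" "d y x = ecc y - p" "d x a = p"
    using geodesic[OF y a(1), of "ecc y - p"] a p by auto
  have "ecc x \<le> p"
  proof -
    obtain z where z: "z \<in> V" "d x z = ecc x" using ecc_attained x by metis
    have "d x z + d y a \<le> max (d x y + d z a) (d x a + d z y)" using four_point x y z a by blast
    moreover have "d z a \<le> diam" "d z y \<le> ecc y" "d x y = d y x"
      using d_le_diam d_le_ecc' d_commute x y z a by blast+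
    ultimately show ?thesis using x z a p by linarith
  qed
  moreover have "p \<le> ecc x" using d_le_ecc[of x a] x a by simp
  ultimately have "x \<in> level p" using x by (simp add: level_def)
  then show ?thesis using x d_commute[of x y] y by auto
qed

text \<open>
  The four-point condition for the two candidates, \<open>y\<close> and a vertex farthest from \<open>y\<close> puts the candidates
  at distance zero.
\<close>

lemma ancestor_unique:
  assumes V: "x \<in> V" "x' \<in> V" "y \<in> V" and ecc: "ecc x' = ecc x" and le: "ecc x \<le> ecc y"
    and d: "d x y = ecc y - ecc x" "d x' y = ecc y - ecc x"
  shows "x = x'"
proof -
  obtain a where a: "a \<in> V" "d y a = ecc y" using ecc_attained V by metis
  have "d x x' + d y a \<le> max (d x y + d x' a) (d x a + d x' y)" using four_point V a by blast
  moreover have "d x a \<le> ecc x" "d x' a \<le> ecc x" using d_le_ecc V a ecc by metis+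
  ultimately have "d x x' = 0" using d a le by linarith
  then show ?thesis using d_zero_iff V by blast
qed

lemma central_level:
  assumes V: "x \<in> V" "y \<in> V" and x: "2 * ecc x = diam"
  shows "d x y = ecc y - ecc x"
  using d_plus_diam_le[OF V] ecc_lipschitz[OF V] x by linarith

lemma central_level_unique:
  assumes "x \<in> V" "y \<in> V" "2 * ecc x = diam" "ecc y = ecc x"
  shows "x = y"
proof -
  have "d x y = ecc y - ecc x" using assms(1-3) by (rule central_level)
  then show ?thesis using assms(4) d_zero_iff[OF assms(1,2)] by simp
qed

definition pair_sum :: "(nat \<Rightarrow> real) \<Rightarrow> nat \<Rightarrow> nat \<Rightarrow> real" where
  "pair_sum f p q = (\<Sum>x\<in>level p. \<Sum>y\<in>level q. f (d x y))"

lemma pair_sum_commute: "pair_sum f p q = pair_sum f q p"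
proof -
  have "pair_sum f p q = (\<Sum>y\<in>level q. \<Sum>x\<in>level p. f (d x y))"
    unfolding pair_sum_def by (rule sum.swap)
  also have "\<dots> = pair_sum f q p"
    unfolding pair_sum_def by (intro sum.cong refl) (metis d_commute levelD(1))
  finally show ?thesis .
qed

lemma sum_by_levels: "(\<Sum>x\<in>V. \<Sum>y\<in>V. f (d x y)) = (\<Sum>p\<le>diam. \<Sum>q\<le>diam. pair_sum f p q)"
proof -
  have group: "(\<Sum>x\<in>V. g x) = (\<Sum>p\<le>diam. \<Sum>x\<in>level p. g x)" for g :: "'a \<Rightarrow> real"
    unfolding level_def using finite_V ecc_le_diam by (intro sum.group[symmetric]) auto
  have "(\<Sum>x\<in>V. \<Sum>y\<in>V. f (d x y)) = (\<Sum>p\<le>diam. \<Sum>x\<in>level p. \<Sum>q\<le>diam. \<Sum>y\<in>level q. f (d x y))"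
    by (simp only: group)
  also have "\<dots> = (\<Sum>p\<le>diam. \<Sum>q\<le>diam. pair_sum f p q)"
    unfolding pair_sum_def by (intro sum.cong refl sum.swap)
  finally show ?thesis .
qed

definition ancestor_pairs :: "nat \<Rightarrow> nat \<Rightarrow> ('a \<times> 'a) set" where
  "ancestor_pairs p q = {(x, y). x \<in> level p \<and> y \<in> level q \<and> d x y = q - p}"

definition cross_pairs :: "nat \<Rightarrow> nat \<Rightarrow> ('a \<times> 'a) set" where
  "cross_pairs p q = {(x, y). x \<in> level p \<and> y \<in> level q \<and> \<not> same_branch x y}"

lemma card_ancestor_pairs:
  assumes "diam \<le> 2 * p" "p \<le> q"
  shows "card (ancestor_pairs p q) = card (level q)"
proof -
  have "bij_betw snd (ancestor_pairs p q) (level q)"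
  proof (rule bij_betw_imageI)
    show "inj_on snd (ancestor_pairs p q)"
    proof (rule inj_onI)
      fix e e' assume e: "e \<in> ancestor_pairs p q" "e' \<in> ancestor_pairs p q" "snd e = snd e'"
      obtain x y x' where xy: "e = (x, y)" "e' = (x', y)" using e by (metis prod.collapse)
      have "x \<in> V" "x' \<in> V" "y \<in> V" "ecc x = p" "ecc x' = p" "ecc y = q" "d x y = q - p" "d x' y = q - p"
        using e xy by (auto simp: ancestor_pairs_def level_def)
      then have "x = x'" using ancestor_unique[of x x' y] assms by simp
      then show "e = e'" using xy by simp
    qed
    show "snd ` ancestor_pairs p q = level q"
    proof (intro equalityI subsetI)
      fix y assume "y \<in> snd ` ancestor_pairs p q"
      then show "y \<in> level q" by (auto simp: ancestor_pairs_def)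
    next
      fix y assume y: "y \<in> level q"
      then obtain x where "x \<in> level p" "d x y = q - p"
        using ancestor_exists[of y p] assms levelD by metis
      then show "y \<in> snd ` ancestor_pairs p q" using y by (force simp: ancestor_pairs_def)
    qed
  qed
  then show ?thesis by (rule bij_betw_same_card)
qed

lemma pair_sum_split:
  assumes A: "A \<subseteq> level p \<times> level q" and C: "C \<subseteq> level p \<times> level q" and disj: "A \<inter> C = {}"
  defines "R \<equiv> level p \<times> level q - A - C"
  shows "pair_sum f p q = (\<Sum>(x, y)\<in>A. f (d x y)) + (\<Sum>(x, y)\<in>C. f (d x y)) + (\<Sum>(x, y)\<in>R. f (d x y))"
    and "real (card R) = real (card (level p)) * real (card (level q)) - real (card A) - real (card C)"
proof -
  define P where "P = level p \<times> level q"
  have fin: "finite P" "finite A" "finite C" "finite R"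
    using finite_level A C finite_subset[of _ P] by (auto simp: P_def R_def)
  have P: "P = A \<union> C \<union> R" "(A \<union> C) \<inter> R = {}" using A C by (auto simp: P_def R_def)
  have "pair_sum f p q = (\<Sum>(x, y)\<in>P. f (d x y))"
    unfolding pair_sum_def P_def by (rule sum.cartesian_product)
  also have "\<dots> = (\<Sum>(x, y)\<in>A. f (d x y)) + (\<Sum>(x, y)\<in>C. f (d x y)) + (\<Sum>(x, y)\<in>R. f (d x y))"
    using fin disj P by (simp add: sum.union_disjoint)
  finally show "pair_sum f p q = \<dots>" .
  have "card P = card A + card C + card R"
    using fin disj P by (simp add: card_Un_disjoint)
  moreover have "card P = card (level p) * card (level q)" unfolding P_def by (rule card_cartesian_product)
  ultimately show "real (card R) =
      real (card (level p)) * real (card (level q)) - real (card A) - real (card C)"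
    by (metis add_diff_cancel_left' diff_diff_eq of_nat_add of_nat_mult)
qed

lemma pair_sum_central:
  assumes "2 * p = diam" "p \<le> q" "card (level p) = 1"
  shows "pair_sum f p q = real (card (level q)) * f (q - p)"
proof -
  obtain c where c: "level p = {c}" using assms(3) by (auto simp: card_1_singleton_iff)
  then have "c \<in> V" "ecc c = p" using levelD[of c p] by auto
  then have "f (d c y) = f (q - p)" if "y \<in> level q" for y
    using central_level[of c y] levelD[OF that] assms by simp
  then show ?thesis unfolding pair_sum_def c by simp
qed

text \<open>
  Here \<open>x0\<close> and \<open>y0\<close> are the vertices of a branch that has only one vertex at each of the two levels. The
  \<open>n + m - 2\<close> pairs that contain exactly one of them account for all the large distances.
\<close>

lemma pair_sum_le_bound:
  assumes mono: "mono f" and p: "diam < 2 * p" "p \<le> q"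
    and x0: "x0 \<in> level p" and y0: "y0 \<in> level q"
    and far: "\<And>y. y \<in> level q \<Longrightarrow> y \<noteq> y0 \<Longrightarrow> d x0 y = p + q - diam"
    and near0: "d x0 y0 = q - p"
    and near: "\<And>x y. x \<in> level p \<Longrightarrow> y \<in> level q \<Longrightarrow> x \<noteq> x0 \<Longrightarrow> y \<noteq> y0 \<Longrightarrow> d x y \<le> q - p + 2"
  shows "pair_sum f p q \<le> pair_bound diam p q (card (level p)) (card (level q)) f"
proof -
  define A where "A = ancestor_pairs p q"
  define C where "C = {x0} \<times> (level q - {y0}) \<union> (level p - {x0}) \<times> {y0}"
  define R where "R = level p \<times> level q - A - C"
  have A: "A \<subseteq> level p \<times> level q" by (auto simp: A_def ancestor_pairs_def)
  have C: "C \<subseteq> level p \<times> level q" using x0 y0 by (auto simp: C_def)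
  have disj: "A \<inter> C = {}"
  proof (rule ccontr)
    assume "A \<inter> C \<noteq> {}"
    then obtain x y where xy: "x \<in> level p" "y \<in> level q" "d x y = q - p" "(x, y) \<in> C"
      by (auto simp: A_def ancestor_pairs_def)
    show False
    proof (cases "x = x0")
      case True
      then have "y \<noteq> y0" using xy by (auto simp: C_def)
      then show False using far[of y] xy True p by simp
    next
      case False
      then have "y = y0" using xy by (auto simp: C_def)
      then show False
        using ancestor_unique[of x x0 y0] levelD[of x p] levelD[of x0 p] levelD[of y0 q] xy x0 y0 near0 False p
        by simp
    qed
  qed
  note split = pair_sum_split(1)[OF A C disj, of f, folded R_def]
    pair_sum_split(2)[OF A C disj, folded R_def]
  have cardC: "real (card C) = real (card (level p)) + real (card (level q)) - 2"
  proof -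
    have "card C = (card (level q) - 1) + (card (level p) - 1)"
      unfolding C_def using finite_level x0 y0
      by (subst card_Un_disjoint) (auto simp: card_cartesian_product)
    moreover have "1 \<le> card (level p)" "1 \<le> card (level q)"
      using finite_level x0 y0 by (auto simp: Suc_le_eq card_gt_0_iff)
    ultimately show ?thesis by simp
  qed
  have cardA: "card A = card (level q)" unfolding A_def using p by (intro card_ancestor_pairs) auto
  have "(\<Sum>(x, y)\<in>A. f (d x y)) = real (card A) * f (q - p)"
  proof -
    have "(\<Sum>(x, y)\<in>A. f (d x y)) = (\<Sum>e\<in>A. f (q - p))"
      by (rule sum.cong) (auto simp: A_def ancestor_pairs_def)
    then show ?thesis by simp
  qed
  moreover have "(\<Sum>(x, y)\<in>C. f (d x y)) \<le> real (card C) * f (p + q - diam)"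
  proof (rule sum_bounded_above)
    fix e assume "e \<in> C"
    then obtain x y where e: "e = (x, y)" "x \<in> level p" "y \<in> level q" using C by auto
    then have "d x y \<le> p + q - diam" using d_plus_diam_le[of x y] levelD[of x p] levelD[of y q] by simp
    then show "(case e of (x, y) \<Rightarrow> f (d x y)) \<le> f (p + q - diam)" using mono e by (simp add: monoD)
  qed
  moreover have "(\<Sum>(x, y)\<in>R. f (d x y)) \<le> real (card R) * f (q - p + 2)"
  proof (rule sum_bounded_above)
    fix e assume "e \<in> R"
    then obtain x y where e: "e = (x, y)" "x \<in> level p" "y \<in> level q" "(x, y) \<notin> A" "(x, y) \<notin> C"
      by (auto simp: R_def)
    then have "(x, y) \<noteq> (x0, y0)" using near0 by (auto simp: A_def ancestor_pairs_def)
    then have "d x y \<le> q - p + 2" using near e by (auto simp: C_def)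
    then show "(case e of (x, y) \<Rightarrow> f (d x y)) \<le> f (q - p + 2)" using mono e by (simp add: monoD)
  qed
  ultimately show ?thesis
    unfolding split(1) pair_bound_def using split(2) cardA cardC by simp
qed

end

section \<open>The two ends of a diametral path\<close>

text \<open>
  Regard \<open>N\<close> as a matrix with rows \<open>X\<close> and columns \<open>Y\<close>. The rows \<open>x1\<close> and \<open>x2\<close> together cover every
  column, and every other row has an entry. The lemma is applied with \<open>N\<close> meaning "in different
  branches" and with \<open>x1\<close>, \<open>x2\<close> taken from two branches, so that no \<open>y\<close> can be in both.
\<close>

lemma cross_count:
  fixes N :: "'a \<Rightarrow> 'b \<Rightarrow> bool"
  assumes fin: "finite X" "finite Y" and x12: "x1 \<in> X" "x2 \<in> X" "x1 \<noteq> x2"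
    and cover: "\<forall>y\<in>Y. N x1 y \<or> N x2 y"
    and each: "\<forall>x\<in>X. \<exists>y\<in>Y. N x y"
  defines "C \<equiv> {(x, y). x \<in> X \<and> y \<in> Y \<and> N x y}"
  shows "card X + card Y - 2 \<le> card C"
    and "card C = card X + card Y - 2 \<Longrightarrow> y \<in> Y \<Longrightarrow> \<not> (N x1 y \<and> N x2 y)"
    and "card C = card X + card Y - 2 \<Longrightarrow> x \<in> X \<Longrightarrow> x \<noteq> x1 \<Longrightarrow> x \<noteq> x2 \<Longrightarrow>
      y \<in> Y \<Longrightarrow> y' \<in> Y \<Longrightarrow> N x y \<Longrightarrow> N x y' \<Longrightarrow> y = y'"
proof -
  define n where "n = (\<lambda>x. card {y \<in> Y. N x y})"
  define X' where "X' = X - {x1, x2}"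
  have "card C = (\<Sum>x\<in>X. n x)"
  proof -
    have "C = Sigma X (\<lambda>x. {y \<in> Y. N x y})" unfolding C_def by auto
    then show ?thesis unfolding n_def using fin by (simp add: card_SigmaI)
  qed
  also have "\<dots> = n x1 + n x2 + (\<Sum>x\<in>X'. n x)"
  proof -
    have "X = insert x1 (insert x2 X')" using x12 X'_def by auto
    moreover have "x1 \<notin> insert x2 X'" "x2 \<notin> X'" "finite X'" using x12 fin X'_def by auto
    ultimately show ?thesis by simp
  qed
  finally have C: "card C = n x1 + n x2 + (\<Sum>x\<in>X'. n x)" .
  have "n x1 + n x2 = card Y + card {y \<in> Y. N x1 y \<and> N x2 y}"
  proof -
    have "{y \<in> Y. N x1 y} \<union> {y \<in> Y. N x2 y} = Y" using cover by auto
    moreover have "{y \<in> Y. N x1 y} \<inter> {y \<in> Y. N x2 y} = {y \<in> Y. N x1 y \<and> N x2 y}" by auto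
    ultimately show ?thesis
      unfolding n_def using card_Un_Int[of "{y \<in> Y. N x1 y}" "{y \<in> Y. N x2 y}"] fin by simp
  qed
  note C' = C[unfolded this]
  have pos: "1 \<le> n x" if "x \<in> X'" for x
  proof -
    have "{y \<in> Y. N x y} \<noteq> {}" using each that X'_def by auto
    then show ?thesis unfolding n_def using fin by (simp add: Suc_le_eq card_gt_0_iff)
  qed
  have X': "card X' + 2 = card X" "finite X'"
    using x12 fin card_mono[of X "{x1, x2}"] unfolding X'_def by (auto simp: card_Diff_subset)
  have sum: "card X' \<le> (\<Sum>x\<in>X'. n x)" using sum_mono[of X' "\<lambda>_. 1" n] pos by simp
  show "card X + card Y - 2 \<le> card C" using C' sum X' by simp
  {
    assume eq: "card C = card X + card Y - 2"
    have e: "card {y \<in> Y. N x1 y \<and> N x2 y} = 0" "(\<Sum>x\<in>X'. n x) = card X'"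
      using C' sum X' eq by auto
    {
      assume "y \<in> Y"
      then show "\<not> (N x1 y \<and> N x2 y)" using e(1) fin by auto
    }
    {
      assume x: "x \<in> X" "x \<noteq> x1" "x \<noteq> x2" and y: "y \<in> Y" "y' \<in> Y" "N x y" "N x y'"
      have "n x = 1"
      proof (rule ccontr)
        assume "n x \<noteq> 1"
        then have "1 < n x" using pos[of x] x X'_def by auto
        then have "(\<Sum>x\<in>X'. 1) < (\<Sum>x\<in>X'. n x)"
          using X'(2) x X'_def pos by (intro sum_strict_mono_ex1) auto
        then show False using e(2) by simp
      qed
      then obtain z where "{y \<in> Y. N x y} = {z}" unfolding n_def by (auto simp: card_1_singleton_iff)
      then have "y \<in> {z}" "y' \<in> {z}" using y by blast+
      then show "y = y'" by blast
    }
  }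
qed

locale tree_diameter = tree_metric +
  fixes a b :: 'a
  assumes a: "a \<in> V" and b: "b \<in> V" and ab: "d a b = diam"
begin

text \<open>
  By the four-point condition for \<open>x\<close>, a vertex farthest from \<open>x\<close>, and the ends of a longest path, no
  vertex is farther from \<open>x\<close> than both ends.
\<close>

lemma ecc_ends: 
  assumes "x \<in> V"
  shows "ecc x = max (d x a) (d x b)"
proof -
  obtain y where y: "y \<in> V" "d x y = ecc x" using ecc_attained assms by metis
  have "d x y + d a b \<le> max (d x a + d y b) (d x b + d y a)" using four_point assms y a b by blast
  moreover have "d y b \<le> diam" "d y a \<le> diam" using d_le_diam y a b by blast+
  moreover have "d x a \<le> ecc x" "d x b \<le> ecc x" using d_le_ecc assms a b by blast+
  ultimately show ?thesis using y ab by linarith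
qed

lemma on_path_unique:
  assumes "x \<in> V" "y \<in> V" "d a x + d x b = diam" "d a y = d a x" "d y b = d x b"
  shows "x = y"
proof -
  have "d x y + d a b \<le> max (d x a + d y b) (d x b + d y a)" using four_point assms(1,2) a b by blast
  then have "d x y = 0" using assms ab d_commute[of x a] d_commute[of y a] a by simp
  then show ?thesis using d_zero_iff assms by blast
qed

definition spine :: "nat \<Rightarrow> 'a" where
  "spine k = (SOME x. x \<in> V \<and> d a x = k \<and> d x b = diam - k)"

lemma spine:
  assumes "k \<le> diam"
  shows "spine k \<in> V" "d a (spine k) = k" "d (spine k) b = diam - k" "d (spine k) a = k"
proof -
  have "\<exists>x. x \<in> V \<and> d a x = k \<and> d x b = diam - k" using geodesic[OF a b] ab assms by auto
  then have "spine k \<in> V \<and> d a (spine k) = k \<and> d (spine k) b = diam - k"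
    unfolding spine_def by (rule someI_ex)
  then show "spine k \<in> V" "d a (spine k) = k" "d (spine k) b = diam - k" by auto
  then show "d (spine k) a = k" using d_commute a by metis
qed

lemma d_spine:
  assumes "i \<le> diam" "j \<le> diam"
  shows "d (spine i) (spine j) = (if i \<le> j then j - i else i - j)"
proof -
  note i = spine[OF assms(1)] and j = spine[OF assms(2)]
  have "d (spine i) (spine j) + d a b \<le>
      max (d (spine i) a + d (spine j) b) (d (spine i) b + d (spine j) a)"
    using four_point i j a b by blast
  moreover have "d a (spine j) \<le> d a (spine i) + d (spine i) (spine j)"
    "d a (spine i) \<le> d a (spine j) + d (spine j) (spine i)"
    "d (spine j) (spine i) = d (spine i) (spine j)"
    using triangle d_commute i(1) j(1) a by blast+
  ultimately show ?thesis using i j ab assms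
    by (cases "i \<le> j"; simp add: max_def split: if_splits)
qed

lemma ecc_spine: "k \<le> diam \<Longrightarrow> ecc (spine k) = max k (diam - k)"
  using ecc_ends[of "spine k"] spine[of k] by simp

lemma on_path_is_spine:
  assumes "x \<in> V" "d a x + d x b = diam"
  shows "x \<in> spine ` {..diam}"
proof -
  have "d a x \<le> diam" using assms by simp
  then have "x = spine (d a x)" using spine[of "d a x"] assms by (intro on_path_unique) auto
  then show ?thesis using \<open>d a x \<le> diam\<close> by blast
qed

lemma same_branch_ends_spine:
  assumes "p \<le> diam" "diam < 2 * p"
  shows "same_branch (spine (diam - p)) a" "same_branch (spine p) b"
    "spine (diam - p) \<in> level p" "spine p \<in> level p" "spine (diam - p) \<noteq> spine p"
proof -
  have e: "ecc a = diam" "ecc b = diam"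
    using ecc_ends[of a] ecc_ends[of b] a b ab d_self d_commute[of b a] by auto
  show 1: "spine (diam - p) \<in> level p" "spine p \<in> level p"
    using spine ecc_spine assms by (auto simp: level_def)
  then show "same_branch (spine (diam - p)) a" "same_branch (spine p) b"
    using levelD[of _ p] spine[of "diam - p"] spine[of p] assms e by (auto simp: same_branch_def)
  have "d (spine (diam - p)) (spine p) \<noteq> 0" using d_spine assms by simp
  then show "spine (diam - p) \<noteq> spine p" using d_self levelD(1)[OF 1(2)] by metis
qed

lemma not_same_branch_ends: "\<not> same_branch a b"
  using ecc_ends[of a] ecc_ends[of b] a b ab d_self d_commute[of b a] by (simp add: same_branch_def)

text \<open>
  A vertex of eccentricity \<open>p\<close> has distance at most \<open>p\<close> from both ends. The two distances cannot both be
  \<open>p\<close>, since then the perimeter \<open>2 * p + diam\<close> would be odd; so they add up to \<open>diam\<close>, and the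
  vertex lies on the longest path.
\<close>

lemma bicentral_level:
  assumes "2 * p = diam + 1" "x \<in> level p"
  shows "x \<in> spine ` {..diam}"
proof (rule on_path_is_spine)
  show x: "x \<in> V" using assms levelD by blast
  have "d x a \<le> p" "d x b \<le> p" using ecc_ends[OF x] levelD(2)[OF assms(2)] by auto
  moreover have "diam \<le> d a x + d x b" using triangle[of a x b] x a b ab by simp
  moreover have "even (d x a + d a b + d b x)" using even_perimeter x a b by blast
  moreover have "d b x = d x b" "d a x = d x a" using d_commute x a b by blast+
  ultimately show "d a x + d x b = diam" using assms(1) ab by presburger
qed

lemma level_on_spine:
  assumes "p \<le> diam"
  shows "level p \<inter> spine ` {..diam} = (if diam \<le> 2 * p then {spine p, spine (diam - p)} else {})"
proof -
  have "x \<in> {spine p, spine (diam - p)} \<and> diam \<le> 2 * p"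
    if x: "x \<in> level p" "x \<in> spine ` {..diam}" for x
  proof -
    obtain k where k: "k \<le> diam" "x = spine k" using x(2) by auto
    have "p = max k (diam - k)" using ecc_spine[OF k(1)] levelD(2)[OF x(1)] k by simp
    then have "(k = p \<or> k = diam - p) \<and> diam \<le> 2 * p" using k(1) by linarith
    then show ?thesis using k by auto
  qed
  moreover have "{spine p, spine (diam - p)} \<subseteq> level p \<inter> spine ` {..diam}" if "diam \<le> 2 * p"
    using that ecc_spine spine assms by (auto simp: level_def)
  ultimately show ?thesis by auto
qed

text \<open>
  The path from \<open>a\<close> to \<open>b\<close> meets both levels once in the branch of \<open>a\<close> and once in the branch of \<open>b\<close>;
  these vertices play the role of \<open>x1\<close> and \<open>x2\<close> in \<open>cross_count\<close>. In the case of equality, \<open>x\<close> is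
  separated from precisely one vertex at level \<open>q\<close>. If \<open>x\<close> is not in the branch of \<open>a\<close>, this one is the
  path vertex in the branch of \<open>a\<close>; but \<open>y\<close>, if not in the branch of \<open>b\<close>, is in that of \<open>a\<close> and would
  be another.
\<close>

lemma cross_pairs_count:
  assumes p: "diam < 2 * p" "p \<le> diam" and q: "diam < 2 * q" "q \<le> diam"
  shows "card (level p) + card (level q) - 2 \<le> card (cross_pairs p q)"
    and "card (cross_pairs p q) = card (level p) + card (level q) - 2 \<Longrightarrow>
      x \<in> level p \<Longrightarrow> x \<notin> spine ` {..diam} \<Longrightarrow> y \<in> level q \<Longrightarrow> y \<notin> spine ` {..diam} \<Longrightarrow>
      same_branch x a \<or> same_branch y b"
proof -
  define x1 x2 y1 y2 where "x1 = spine (diam - p)" "x2 = spine p" "y1 = spine (diam - q)" "y2 = spine q"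
  note defs = x1_x2_y1_y2_def
  note xs = same_branch_ends_spine[OF p(2,1), folded defs]
  note ys = same_branch_ends_spine[OF q(2,1), folded defs]
  have V: "x1 \<in> V" "x2 \<in> V" "y1 \<in> V" "y2 \<in> V" using xs ys levelD by blast+
  have not_both: "\<not> (same_branch u z \<and> same_branch v z)"
    if "u \<in> V" "v \<in> V" "z \<in> V" "same_branch u a" "same_branch v b" for u v z
  proof
    assume uv: "same_branch u z \<and> same_branch v z"
    have "same_branch a u" using same_branch_sym that a by blast
    then have "same_branch a z" using same_branch_trans that uv a by blast
    moreover have "same_branch z v" using same_branch_sym that uv by blast
    ultimately have "same_branch a v" using same_branch_trans that a by blast
    then have "same_branch a b" using same_branch_trans that a b by blast
    then show False using not_same_branch_ends by blast
  qed
  have cover: "\<forall>y\<in>level q. \<not> same_branch x1 y \<or> \<not> same_branch x2 y"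
    using not_both[of x1 x2] V xs levelD(1) by blast
  have each: "\<forall>x\<in>level p. \<exists>y\<in>level q. \<not> same_branch x y"
  proof
    fix x assume x: "x \<in> level p"
    have "\<not> (same_branch y1 x \<and> same_branch y2 x)" using not_both[of y1 y2 x] V ys levelD(1)[OF x] by blast
    then show "\<exists>y\<in>level q. \<not> same_branch x y" using same_branch_sym[of x] levelD(1)[OF x] V ys by blast
  qed
  note count = cross_count[where N = "\<lambda>x y. \<not> same_branch x y", OF finite_level finite_level xs(3,4,5) cover each, folded cross_pairs_def]
  show "card (level p) + card (level q) - 2 \<le> card (cross_pairs p q)" using count(1) .
  assume eq: "card (cross_pairs p q) = card (level p) + card (level q) - 2"
    and x: "x \<in> level p" "x \<notin> spine ` {..diam}" and y: "y \<in> level q" "y \<notin> spine ` {..diam}"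
  show "same_branch x a \<or> same_branch y b"
  proof (rule ccontr)
    assume no: "\<not> (same_branch x a \<or> same_branch y b)"
    have xV: "x \<in> V" and yV: "y \<in> V" using x y levelD by blast+
    have "\<not> same_branch x2 y"
      using no same_branch_trans[of y x2 b] same_branch_sym[of x2 y] yV V xs b by blast
    then have "same_branch x1 y" using count(2)[OF eq y(1)] by blast
    then have ya: "same_branch y a"
      using same_branch_sym[of x1 y] same_branch_trans[of y x1 a] xs V yV a by blast
    have x12: "x \<noteq> x1" "x \<noteq> x2" using x p unfolding defs by auto
    have "\<not> same_branch x y1" using no same_branch_trans[of x y1 a] ys V xV a by blast
    moreover have "\<not> same_branch x y" using no same_branch_trans[of x y a] ya yV xV a by blast
    ultimately have "y = y1" using count(3)[OF eq x(1) x12 y(1) ys(3)] by blast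
    then show False using y q unfolding defs by auto
  qed
qed

lemma card_bicentral_level:
  assumes "2 * p = diam + 1"
  shows "card (level p) = 2"
proof -
  have p: "p \<le> diam" "diam < 2 * p"
  proof -
    show "diam < 2 * p" using assms by simp
    have "diam \<noteq> 0" using assms by presburger
    then show "p \<le> diam" using assms by simp
  qed
  have "level p = level p \<inter> spine ` {..diam}" using bicentral_level[OF assms] by blast
  also have "\<dots> = {spine p, spine (diam - p)}" using level_on_spine[OF p(1)] p(2) by simp
  finally show ?thesis using same_branch_ends_spine(5)[OF p] by auto
qed

end

context tree_metric
begin

lemma tree_diameter_exists: obtains a b where "tree_diameter V d a b"
proof -
  obtain a b where "a \<in> V" "b \<in> V" "d a b = diam" by (rule diam_attained)
  then have "tree_diameter V d a b" by unfold_locales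
  then show thesis by (rule that)
qed

lemma two_le_card_level:
  assumes "diam < 2 * p" "p \<le> diam"
  shows "2 \<le> card (level p)"
proof -
  obtain a b where "tree_diameter V d a b" by (rule tree_diameter_exists)
  then interpret tree_diameter V d a b .
  show ?thesis
    using card_mono[OF finite_level, of "{spine (diam - p), spine p}" p]
      same_branch_ends_spine[OF assms(2,1)] by simp
qed

text \<open>
  The ancestor pairs are fixed in number and distance, and the cross pairs are fixed in distance. What can
  exceed the bound is the distance of the other pairs, and the number of cross pairs at the expense of
  the others, whose least distance is \<open>q - p + 2\<close>. The latter does not reduce the sum, since
  \<open>q - p + 2 \<le> p + q - diam\<close> unless \<open>2 * p = diam + 1\<close>, when there are no other pairs at all. The second
  and the third claim say that neither kind of excess occurs if the bound is attained.
\<close>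

lemma pair_sum_ge_bound:
  assumes mono: "strict_mono f" and p: "diam < 2 * p" "p \<le> q" "q \<le> diam"
  shows "pair_bound diam p q (card (level p)) (card (level q)) f \<le> pair_sum f p q"
    and "pair_sum f p q = pair_bound diam p q (card (level p)) (card (level q)) f \<Longrightarrow>
      x \<in> level p \<Longrightarrow> y \<in> level q \<Longrightarrow> same_branch x y \<Longrightarrow> d x y \<noteq> q - p \<Longrightarrow> d x y = q - p + 2"
    and "pair_sum f p q = pair_bound diam p q (card (level p)) (card (level q)) f \<Longrightarrow>
      diam + 3 \<le> 2 * p \<Longrightarrow> card (cross_pairs p q) = card (level p) + card (level q) - 2"
proof -
  define n m where "n = card (level p)" "m = card (level q)"
  define A where "A = ancestor_pairs p q"
  define C where "C = cross_pairs p q"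
  define R where "R = level p \<times> level q - A - C"
  obtain a b where "tree_diameter V d a b" by (rule tree_diameter_exists)
  then interpret tree_diameter V d a b .
  have A: "A \<subseteq> level p \<times> level q" by (auto simp: A_def ancestor_pairs_def)
  have C: "C \<subseteq> level p \<times> level q" by (auto simp: C_def cross_pairs_def)
  have C_dist: "d x y = p + q - diam" if "(x, y) \<in> C" for x y
    using that not_same_branch_iff[of x y] levelD[of x p] levelD[of y q]
    by (simp add: C_def cross_pairs_def) 
  have disj: "A \<inter> C = {}"
  proof (rule ccontr)
    assume "A \<inter> C \<noteq> {}"
    then obtain x y where "(x, y) \<in> A" "(x, y) \<in> C" by auto
    then have "d x y = q - p" "d x y = p + q - diam" using C_dist by (auto simp: A_def ancestor_pairs_def)
    then show False using p by simp
  qed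
  note split = pair_sum_split(1)[OF A C disj, of f, folded R_def]
    pair_sum_split(2)[OF A C disj, folded R_def n_m_def]
  have cardA: "card A = m" unfolding A_def n_m_def using p by (intro card_ancestor_pairs) auto
  have nm: "2 \<le> n" "2 \<le> m"
    using two_le_card_level[of p] two_le_card_level[of q] p unfolding n_m_def by auto
  have R_dist: "q - p + 2 \<le> d x y" "d x y < p + q - diam" if "(x, y) \<in> R" for x y
  proof -
    have xy: "x \<in> V" "y \<in> V" "ecc x = p" "ecc y = q" "same_branch x y" "d x y \<noteq> q - p"
      using that by (auto simp: R_def A_def C_def ancestor_pairs_def cross_pairs_def level_def)
    then show "q - p + 2 \<le> d x y" using ancestor_or_far[of x y] p by simp
    show "d x y < p + q - diam" using xy by (simp add: same_branch_def)
  qed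
  have cardC: "n + m - 2 \<le> card C"
    using cross_pairs_count(1)[of p q] p unfolding n_m_def C_def by simp
  have sumA: "(\<Sum>(x, y)\<in>A. f (d x y)) = real m * f (q - p)"
  proof -
    have "(\<Sum>(x, y)\<in>A. f (d x y)) = (\<Sum>e\<in>A. f (q - p))"
      by (rule sum.cong) (auto simp: A_def ancestor_pairs_def)
    then show ?thesis using cardA by simp
  qed
  have sumC: "(\<Sum>(x, y)\<in>C. f (d x y)) = real (card C) * f (p + q - diam)"
  proof -
    have "(\<Sum>(x, y)\<in>C. f (d x y)) = (\<Sum>e\<in>C. f (p + q - diam))"
      by (rule sum.cong) (auto simp: C_dist)
    then show ?thesis by simp
  qed
  \<comment> \<open>The excess of the distances in a common branch, and the gain from additional cross pairs.\<close>
  define excess where "excess = (\<Sum>(x, y)\<in>R. f (d x y) - f (q - p + 2))"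
  have excess: "(\<Sum>(x, y)\<in>R. f (d x y)) = real (card R) * f (q - p + 2) + excess"
    unfolding excess_def by (simp add: case_prod_unfold sum_subtractf)
  have term_nonneg: "0 \<le> (case e of (x, y) \<Rightarrow> f (d x y) - f (q - p + 2))" if "e \<in> R" for e
    using that R_dist(1) strict_mono_mono[OF mono] by (auto simp: monoD split: prod.split)
  have excess_nonneg: "0 \<le> excess"
    unfolding excess_def by (rule sum_nonneg) (rule term_nonneg)
  define gain where "gain = (real (card C) - (real n + real m - 2)) * (f (p + q - diam) - f (q - p + 2))"
  have diff: "pair_sum f p q - pair_bound diam p q n m f = excess + gain"
  proof -
    have cardR: "real (card R) = real n * real m - real m - real (card C)" using split(2) cardA by simp
    show ?thesis
      unfolding split(1) pair_bound_def sumA sumC excess gain_def cardR by (simp add: algebra_simps)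
  qed
  have gain_nonneg: "0 \<le> gain"
  proof (cases "2 * p = diam + 1")
    case True
    have "R = {}" using R_dist True p by force
    then have "real (card C) = real n + real m - 2"
      using split(2) cardA card_bicentral_level[OF True] n_m_def by simp
    then show ?thesis by (simp add: gain_def)
  next
    case False
    then have "q - p + 2 \<le> p + q - diam" using p by linarith
    then have "f (q - p + 2) \<le> f (p + q - diam)" using strict_mono_mono[OF mono] by (auto simp: monoD)
    moreover have "real n + real m - 2 \<le> real (card C)" using cardC nm by linarith
    ultimately show ?thesis unfolding gain_def by simp
  qed
  show "pair_bound diam p q (card (level p)) (card (level q)) f \<le> pair_sum f p q"
    using diff excess_nonneg gain_nonneg n_m_def by simp
  assume "pair_sum f p q = pair_bound diam p q (card (level p)) (card (level q)) f"
  then have zero: "excess = 0" "gain = 0" using diff excess_nonneg gain_nonneg n_m_def by auto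
  {
    assume xy: "x \<in> level p" "y \<in> level q" "same_branch x y" "d x y \<noteq> q - p"
    then have R: "(x, y) \<in> R"
      by (auto simp: R_def A_def C_def ancestor_pairs_def cross_pairs_def)
    have "finite R" unfolding R_def using finite_level by auto
    then have "f (d x y) - f (q - p + 2) = 0"
      using zero(1) R term_nonneg sum_nonneg_eq_0_iff[of R "\<lambda>(x, y). f (d x y) - f (q - p + 2)"]
      unfolding excess_def by auto
    then show "d x y = q - p + 2" using strict_mono_eq[OF mono] by simp
  }
  assume "diam + 3 \<le> 2 * p"
  then have "q - p + 2 < p + q - diam" using p by linarith
  then have "f (q - p + 2) < f (p + q - diam)" using mono by (simp add: strict_mono_less)
  then have "real (card C) = real n + real m - 2" using zero(2) unfolding gain_def by simp
  then show "card (cross_pairs p q) = card (level p) + card (level q) - 2"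
    using nm unfolding C_def n_m_def by linarith
qed

text \<open>
  At the levels \<open>p\<close> with \<open>diam + 3 \<le> 2 * p\<close> the bound is attained only if there are as few cross pairs as
  possible. By \<open>cross_pairs_count\<close> it cannot happen that \<open>x\<close> and \<open>y\<close> at such levels are off the path from
  \<open>a\<close> to \<open>b\<close>, with \<open>x\<close> outside the branch of \<open>a\<close> and \<open>y\<close> outside that of \<open>b\<close>. So, possibly after exchanging
  \<open>a\<close> and \<open>b\<close>, every vertex off the path at these levels is in the branch of \<open>a\<close>. It then has distance
  \<open>2\<close> from the path vertex at its own level in this branch, and therefore the same parent. A vertex at a
  level with \<open>2 * p = diam + 2\<close> is adjacent to the central vertex, and the lower levels lie on the path.
\<close>

lemma tight_imp_caterpillar:
  assumes mono: "strict_mono f"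
    and tight: "\<And>p q. diam < 2 * p \<Longrightarrow> p \<le> q \<Longrightarrow> q \<le> diam \<Longrightarrow>
      pair_sum f p q = pair_bound diam p q (card (level p)) (card (level q)) f"
  obtains a b where "tree_diameter V d a b"
    "\<And>x. x \<in> V \<Longrightarrow> x \<notin> tree_diameter.spine V d a b ` {..diam} \<Longrightarrow>
      d x (tree_diameter.spine V d a b (diam + 1 - ecc x)) = 1"
proof -
  have oriented: "d x (tree_diameter.spine V d a b (diam + 1 - ecc x)) = 1"
    if td: "tree_diameter V d a b"
      and side: "\<And>x. x \<in> V \<Longrightarrow> x \<notin> tree_diameter.spine V d a b ` {..diam} \<Longrightarrow>
          diam + 3 \<le> 2 * ecc x \<Longrightarrow> same_branch x a"
      and x: "x \<in> V" "x \<notin> tree_diameter.spine V d a b ` {..diam}" for a b x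
  proof -
    interpret tree_diameter V d a b by (rule td)
    define p where "p = ecc x"
    have p: "diam \<le> 2 * p" "p \<le> diam"
      using diam_le_twice_ecc ecc_le_diam x p_def by auto
    have xp: "x \<in> level p" using x p_def by (simp add: level_def)
    have "2 * p \<noteq> diam"
    proof
      assume 2: "2 * p = diam"
      then have "spine p \<in> V" "ecc (spine p) = p" using spine[of p] ecc_spine[of p] by auto
      then have "x = spine p" using central_level_unique[of x "spine p"] x 2 p_def by simp
      then show False using x p by blast
    qed
    moreover have "2 * p \<noteq> diam + 1" using bicentral_level[of p x] xp x by blast
    ultimately have p2: "diam + 2 \<le> 2 * p" using p by linarith
    define y where "y = spine (diam + 1 - p)"
    have k: "diam + 1 - p \<le> diam" using p p2 by linarith
    have y: "y \<in> V" "ecc y = p - 1" "d a y = diam + 1 - p" "d y b = p - 1"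
      using spine[OF k] ecc_spine[OF k] p p2 unfolding y_def by auto
    have "d x y \<le> 1"
    proof (cases "2 * p = diam + 2")
      case True
      then show ?thesis using d_plus_diam_le[of x y] x y p_def by simp
    next
      case False
      then have p3: "diam + 3 \<le> 2 * p" using p2 by simp
      define w where "w = spine (diam - p)"
      have w: "w \<in> level p" "same_branch w a" "w \<in> V" "d w b = p" "w \<noteq> x"
        using same_branch_ends_spine[of p] spine[of "diam - p"] p p3 x unfolding w_def by auto
      have "same_branch x a" using side x p3 p_def by simp
      then have "same_branch x w"
        using same_branch_trans[of x a w] same_branch_sym[of w a] w x a by blast
      moreover have "d x w \<noteq> 0" using d_zero_iff w x by metis
      ultimately have "d x w = 2"
        using pair_sum_ge_bound(2)[OF mono _ _ _ tight, of p p x w] p p2 xp w by simp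
      moreover have "d w y = 1" using d_spine[of "diam - p" "diam + 1 - p"] p p2 unfolding w_def y_def by simp
      moreover have "d x y + d w b \<le> max (d x w + d y b) (d x b + d y w)"
        using four_point x y w b by blast
      moreover have "d x b \<le> p" using d_le_ecc[of x b] x b p_def by simp
      moreover have "d y w = d w y" using d_commute y w by blast
      ultimately show ?thesis using w y p2 by linarith
    qed
    moreover have "d x y \<noteq> 0" using d_zero_iff[of x y] x k y_def y by blast
    ultimately show ?thesis unfolding y_def p_def by simp
  qed
  obtain a b where td: "tree_diameter V d a b" by (rule tree_diameter_exists)
  interpret tree_diameter V d a b by (rule td)
  interpret rev: tree_diameter V d b a
    using a b ab d_commute by unfold_locales auto
  \<comment> \<open>The path read in the opposite direction.\<close>
  have spine_rev: "rev.spine k = spine (diam - k)" if "k \<le> diam" for k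
    using spine[of "diam - k"] rev.spine[OF that] that d_commute a b
    by (intro on_path_unique) auto
  have spine_rev_image: "rev.spine ` {..diam} = spine ` {..diam}"
  proof -
    have "rev.spine ` {..diam} = spine ` ((-) diam ` {..diam})" using spine_rev by (auto simp: image_image)
    also have "(-) diam ` {..diam} = {..diam}"
    proof (intro equalityI subsetI)
      fix k assume "k \<in> {..diam}"
      then have "k = diam - (diam - k)" "diam - k \<in> {..diam}" by auto
      then show "k \<in> (-) diam ` {..diam}" by (rule image_eqI)
    qed auto
    finally show ?thesis .
  qed
  have sides: "same_branch x a \<or> same_branch y b"
    if x: "x \<in> V" "x \<notin> spine ` {..diam}" "diam + 3 \<le> 2 * ecc x"
      and y: "y \<in> V" "y \<notin> spine ` {..diam}" "diam + 3 \<le> 2 * ecc y" for x y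
  proof (cases "ecc x \<le> ecc y")
    case True
    then have "card (cross_pairs (ecc x) (ecc y)) = card (level (ecc x)) + card (level (ecc y)) - 2"
      using pair_sum_ge_bound(3)[OF mono _ _ _ tight, of "ecc x" "ecc y"] x y ecc_le_diam by simp
    then show ?thesis
      using cross_pairs_count(2)[of "ecc x" "ecc y" x y] x y ecc_le_diam by (simp add: level_def)
  next
    case False
    then have "card (cross_pairs (ecc y) (ecc x)) = card (level (ecc y)) + card (level (ecc x)) - 2"
      using pair_sum_ge_bound(3)[OF mono _ _ _ tight, of "ecc y" "ecc x"] x y ecc_le_diam by simp
    then have "same_branch y b \<or> same_branch x a"
      using rev.cross_pairs_count(2)[of "ecc y" "ecc x" y x] x y ecc_le_diam
      unfolding spine_rev_image by (simp add: level_def)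
    then show ?thesis by blast
  qed
  show thesis
  proof (cases "\<forall>x\<in>V. x \<notin> spine ` {..diam} \<longrightarrow> diam + 3 \<le> 2 * ecc x \<longrightarrow> same_branch x a")
    case True
    show ?thesis
    proof (rule that[OF td])
      fix x assume x: "x \<in> V" "x \<notin> spine ` {..diam}"
      show "d x (spine (diam + 1 - ecc x)) = 1"
        by (rule oriented[OF td _ x]) (use True in blast)
    qed
  next
    case False
    then have side: "same_branch y b"
      if "y \<in> V" "y \<notin> spine ` {..diam}" "diam + 3 \<le> 2 * ecc y" for y
      using sides that by blast
    show ?thesis
    proof (rule that[OF rev.tree_diameter_axioms])
      fix x assume x: "x \<in> V" "x \<notin> rev.spine ` {..diam}"
      show "d x (rev.spine (diam + 1 - ecc x)) = 1"
        by (rule oriented[OF rev.tree_diameter_axioms _ x]) (unfold spine_rev_image, rule side)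
    qed
  qed
qed

lemma level_nonempty_iff: "level p \<noteq> {} \<longleftrightarrow> diam \<le> 2 * p \<and> p \<le> diam"
proof
  assume "level p \<noteq> {}"
  then obtain x where "x \<in> V" "ecc x = p" by (auto simp: level_def)
  then show "diam \<le> 2 * p \<and> p \<le> diam" using diam_le_twice_ecc[of x] ecc_le_diam[of x] by simp
next
  assume p: "diam \<le> 2 * p \<and> p \<le> diam"
  obtain a b where ab: "a \<in> V" "b \<in> V" "d a b = diam" by (rule diam_attained)
  then have "diam \<le> ecc b" using d_le_ecc' by metis
  then show "level p \<noteq> {}" using ancestor_exists[of b p] ab p by auto
qed

lemma card_central_level:
  assumes "diam \<le> 2 * p" "2 * p \<le> diam + 1"
  shows "card (level p) = (if 2 * p = diam then 1 else 2)"
proof (cases "2 * p = diam")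
  case True
  then obtain c where c: "c \<in> level p" using level_nonempty_iff[of p] by auto
  have "level p = {c}"
  proof -
    have "x = c" if "x \<in> level p" for x
      using central_level_unique[of x c] levelD[OF that] levelD[OF c] True by simp
    then show ?thesis using c by blast
  qed
  then show ?thesis using True by simp
next
  case False
  obtain a b where "tree_diameter V d a b" by (rule tree_diameter_exists)
  then interpret tree_diameter V d a b .
  show ?thesis using card_bicentral_level[of p] False assms by simp
qed

end

section \<open>Distances in trees\<close>

context pair_graph
begin

lemma gdist_le_length: "awalk u p v \<Longrightarrow> gdist G u v \<le> length p"
  unfolding gdist_def by (rule cINF_lower) auto

lemma shortest_awalk:
  assumes "awalk u q v"
  obtains p where "awalk u p v" "length p = gdist G u v"
proof -
  have "gdist G u v \<in> length ` {p. awalk u p v}"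
    unfolding gdist_def using assms by (intro Inf_nat_def1) auto
  then show thesis using that by auto
qed

text \<open>
  A function that changes by at most one along each arc is at most the distance, and it is at least the
  distance if it can be decreased by a step from every vertex other than \<open>x\<close>.
\<close>

lemma gdist_eqI:
  assumes refl: "\<And>x. x \<in> pverts G \<Longrightarrow> f x x = 0"
    and step: "\<And>x y y'. x \<in> pverts G \<Longrightarrow> (y, y') \<in> parcs G \<Longrightarrow> f x y' \<le> Suc (f x y)"
    and descent: "\<And>x y. x \<in> pverts G \<Longrightarrow> y \<in> pverts G \<Longrightarrow> x \<noteq> y \<Longrightarrow>
      \<exists>y'. (y', y) \<in> parcs G \<and> f x y = Suc (f x y')"
    and x: "x \<in> pverts G" and y: "y \<in> pverts G"
  shows "gdist G x y = f x y" and "\<exists>p. awalk x p y"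
proof -
  have upper: "\<exists>p. awalk x p z \<and> length p = f x z" if "z \<in> pverts G" for z
    using that
  proof (induction "f x z" arbitrary: z)
    case 0
    then have "x = z" using descent[OF x] by (metis Zero_not_Suc)
    then show ?case using 0 x by (intro exI[of _ "[]"]) (auto simp: awalk_Nil_iff)
  next
    case (Suc n)
    then have "x \<noteq> z" using refl x by auto
    then obtain z' where z': "(z', z) \<in> parcs G" "f x z = Suc (f x z')"
      using descent[OF x Suc.prems] by blast
    then obtain p where p: "awalk x p z'" "length p = f x z'"
      using Suc.hyps(1)[of z'] Suc.hyps(2) in_arcsD1 by auto
    have "awalk x (p @ [(z', z)]) z"
      using p z' Suc.prems in_arcsD1 by (auto simp: awalk_simps)
    then show ?case using p z' by (intro exI[of _ "p @ [(z', z)]"]) auto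
  qed
  have lower: "f x v \<le> f x u + length p" if "awalk u p v" for u p v
    using that
  proof (induction p arbitrary: u)
    case Nil
    then show ?case by (auto simp: awalk_Nil_iff)
  next
    case (Cons e p)
    then have "(u, snd e) \<in> parcs G" "awalk (snd e) p v" by (auto simp: awalk_Cons_iff)
    then show ?case using Cons.IH[of "snd e"] step[OF x, of u "snd e"] by auto
  qed
  obtain p where p: "awalk x p y" "length p = f x y" using upper[OF y] by blast
  obtain q where q: "awalk x q y" "length q = gdist G x y" by (rule shortest_awalk[OF p(1)])
  have "f x y \<le> gdist G x y" using lower[OF q(1)] q refl[OF x] by simp
  moreover have "gdist G x y \<le> f x y" using gdist_le_length[OF p(1)] p by simp
  ultimately show "gdist G x y = f x y" by simp
  show "\<exists>p. awalk x p y" using p by blast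
qed

lemma connectedI_awalk:
  assumes "pverts G \<noteq> {}" and "\<And>x y. x \<in> pverts G \<Longrightarrow> y \<in> pverts G \<Longrightarrow> \<exists>p. awalk x p y"
  shows "connected (with_proj G)"
proof -
  have "(x, y) \<in> rtrancl_on (pverts G) ((parcs G)\<^sup>s)" if "x \<in> pverts G" "y \<in> pverts G" for x y
  proof (rule rtrancl_on_mono)
    show "(x, y) \<in> rtrancl_on (pverts G) (parcs G)"
      using assms(2)[OF that] reachable_awalk[of x y] by (simp add: reachable_def)
  qed (auto simp: symcl_def)
  then show ?thesis using assms(1) by (simp add: connected_conv)
qed

text \<open>
  On a cycle of length at least three, a vertex at which \<open>h\<close> is greatest would have two different
  neighbours with no greater value of \<open>h\<close>.
\<close>

lemma no_long_cycle:
  fixes h :: "'a \<Rightarrow> nat"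
  assumes unique: "\<And>x y y'. (x, y) \<in> parcs G \<Longrightarrow> (x, y') \<in> parcs G \<Longrightarrow>
      h y \<le> h x \<Longrightarrow> h y' \<le> h x \<Longrightarrow> y = y'"
  shows "\<not> (\<exists>p. cycle p \<and> 3 \<le> length p)"
proof
  assume "\<exists>p. cycle p \<and> 3 \<le> length p"
  then obtain p u where p: "awalk u p u" "distinct (tl (pawalk_verts u p))" "3 \<le> length p"
    unfolding cycle_def by auto
  define m where "m = length p"
  define x where "x = (\<lambda>i. pawalk_verts u p ! i)"
  have arc_nth: "q ! i = (pawalk_verts v q ! i, pawalk_verts v q ! Suc i)"
    if "pcas v q w" "i < length q" for v w q i
    using that
  proof (induction q arbitrary: v i)
    case (Cons e q)
    have 0: "pawalk_verts v' q ! 0 = v'" if "pcas v' q w" for v'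
      using that by (cases q) auto
    show ?case using Cons 0 by (cases i) auto
  qed simp
  have len: "length (pawalk_verts u p) = Suc m"
    unfolding m_def by (induction p arbitrary: u) auto
  have cas: "pcas u p u" using p by blast
  have arc: "(x i, x (Suc i)) \<in> parcs G" if "i < m" for i
    using arc_nth[OF cas] that p nth_mem[of i p] unfolding m_def x_def by fastforce
  have "x 0 = u" using cas p unfolding x_def by (cases p) auto
  have "x m = u"
  proof -
    have "pcas v q w \<Longrightarrow> pawalk_verts v q ! length q = w" for v w q
      by (induction q arbitrary: v) auto
    from this[OF cas] show ?thesis unfolding x_def m_def .
  qed
  have inj: "inj_on x {1..m}"
  proof (rule inj_onI)
    fix i j assume ij: "i \<in> {1..m}" "j \<in> {1..m}" "x i = x j"
    have "tl (pawalk_verts u p) ! (i - 1) = tl (pawalk_verts u p) ! (j - 1)"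
      using ij len by (auto simp: nth_tl x_def Suc_le_eq)
    then have "i - 1 = j - 1" using p(2) ij len by (subst (asm) nth_eq_iff_index_eq) auto
    then show "i = j" using ij by auto
  qed
  have "3 \<le> m" using p m_def by simp
  obtain i where i: "i \<in> {1..m}" "\<And>j. j \<in> {1..m} \<Longrightarrow> h (x j) \<le> h (x i)"
  proof -
    have "finite ((h \<circ> x) ` {1..m})" "(h \<circ> x) ` {1..m} \<noteq> {}" using \<open>3 \<le> m\<close> by auto
    from Max_in[OF this] obtain i where "i \<in> {1..m}" "h (x i) = Max ((h \<circ> x) ` {1..m})" by auto
    then show thesis using that[of i] by simp
  qed
  \<comment> \<open>The neighbours of \<open>x i\<close> on the cycle: \<open>x 0\<close> and \<open>x m\<close> are the same vertex, and the indices are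
    chosen from \<open>{1..m}\<close>, where \<open>x\<close> is injective.\<close>
  define s where "s = (if i = m then 1 else Suc i)"
  define t where "t = (if i = 1 then m else i - 1)"
  have st: "s \<in> {1..m}" "t \<in> {1..m}" "s \<noteq> t" using i \<open>3 \<le> m\<close> unfolding s_def t_def by auto
  have "(x i, x s) \<in> parcs G"
    using arc[of i] arc[of 0] i \<open>3 \<le> m\<close> \<open>x 0 = u\<close> \<open>x m = u\<close> unfolding s_def by auto
  moreover have "(x t, x i) \<in> parcs G"
    using arc[of "i - 1"] i \<open>3 \<le> m\<close> \<open>x 0 = u\<close> \<open>x m = u\<close> unfolding t_def by (auto split: if_splits)
  then have "(x i, x t) \<in> parcs G" by (rule arcs_symmetric)
  ultimately have "x s = x t" using unique i st by blast
  then show False using inj st by (auto dest: inj_onD)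
qed

end

locale tree_graph = pair_graph +
  assumes conn: "connected (with_proj G)"
    and acyclic: "\<not> (\<exists>p. cycle p \<and> 3 \<le> length p)"
begin

lemma verts_nonempty: "pverts G \<noteq> {}"
  using conn by (auto simp: connected_conv)

lemma awalk_exists:
  assumes "u \<in> pverts G" "v \<in> pverts G"
  obtains p where "awalk u p v"
proof -
  have "strongly_connected (with_proj G)"
    using sym_arcs conn by (rule symmetric_connected_imp_strongly_connected)
  then have "u \<rightarrow>\<^sup>*\<^bsub>with_proj G\<^esub> v" using assms by (auto simp: strongly_connected_def)
  then show thesis using that by (auto simp: reachable_awalk)
qed

lemma gdist_awalk:
  assumes "u \<in> pverts G" "v \<in> pverts G"
  obtains p where "awalk u p v" "length p = gdist G u v"
  using awalk_exists[OF assms] shortest_awalk by metis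

lemma gdist_triangle:
  assumes "x \<in> pverts G" "y \<in> pverts G" "z \<in> pverts G"
  shows "gdist G x z \<le> gdist G x y + gdist G y z"
proof -
  obtain p where p: "awalk x p y" "length p = gdist G x y" using gdist_awalk assms by metis
  obtain q where q: "awalk y q z" "length q = gdist G y z" using gdist_awalk assms by metis
  have "awalk x (p @ q) z" using p q by auto
  then show ?thesis using gdist_le_length[of x "p @ q" z] p q by simp
qed

lemma gdist_eq_0_iff:
  assumes "x \<in> pverts G" "y \<in> pverts G"
  shows "gdist G x y = 0 \<longleftrightarrow> x = y"
proof
  assume 0: "gdist G x y = 0"
  obtain p where p: "awalk x p y" "length p = gdist G x y" using gdist_awalk assms by metis
  then show "x = y" using 0 by (auto simp: awalk_Nil_iff)
next
  assume "x = y"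
  then have "awalk x [] y" using assms by (simp add: awalk_Nil_iff)
  then show "gdist G x y = 0" using gdist_le_length[of x "[]" y] by simp
qed

lemma gdist_eq_1_iff:
  assumes "x \<in> pverts G" "y \<in> pverts G"
  shows "gdist G x y = 1 \<longleftrightarrow> (x, y) \<in> parcs G"
proof
  assume 1: "gdist G x y = 1"
  obtain p where p: "awalk x p y" "length p = gdist G x y" using gdist_awalk assms by metis
  then obtain e where "p = [e]" using 1 by (auto simp: length_Suc_conv)
  then show "(x, y) \<in> parcs G" using p by (cases e) (auto simp: awalk_simps)
next
  assume xy: "(x, y) \<in> parcs G"
  then have "awalk x [(x, y)] y" using assms by (simp add: awalk_simps)
  then have "gdist G x y \<le> 1" using gdist_le_length[of x "[(x, y)]" y] by simp
  moreover have "x \<noteq> y" using xy no_loops' by auto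
  ultimately show "gdist G x y = 1" using gdist_eq_0_iff[OF assms] by linarith
qed

lemma gdist_geodesic:
  assumes "x \<in> pverts G" "y \<in> pverts G" "k \<le> gdist G x y"
  shows "\<exists>z\<in>pverts G. gdist G x z = k \<and> gdist G z y = gdist G x y - k"
proof -
  obtain p where p: "awalk x p y" "length p = gdist G x y" using gdist_awalk assms by metis
  have "awalk x (take k p @ drop k p) y" using p by simp
  then obtain z where z: "awalk x (take k p) z" "awalk z (drop k p) y"
    unfolding awalk_append_iff by blast
  have zV: "z \<in> pverts G" using z(2) by (rule awalk_hd_in_verts)
  have "gdist G x z \<le> k" "gdist G z y \<le> gdist G x y - k"
    using gdist_le_length[OF z(1)] gdist_le_length[OF z(2)] p assms(3) by auto
  moreover have "gdist G x y \<le> gdist G x z + gdist G z y" using gdist_triangle assms zV by blast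
  ultimately show ?thesis using zV assms(3) by (intro bexI[of _ z]) auto
qed

text \<open>
  A path inside the walk \<open>p\<close>, closed by the arc from \<open>u\<close> to \<open>w\<close>, would be a cycle. Its length is at least
  three since \<open>p\<close> does not use the arc back.
\<close>

lemma edge_is_bridge:
  assumes uw: "(u, w) \<in> parcs G" and p: "awalk w p u"
    and avoid: "(u, w) \<notin> set p" "(w, u) \<notin> set p"
  shows False
proof -
  define q where "q = awalk_to_apath p"
  have q: "apath w q u" "set q \<subseteq> set p"
    unfolding q_def using p apath_awalk_to_apath awalk_to_apath_subset by blast+
  have "u \<noteq> w" using uw no_loops' by auto
  have "awalk u ((u, w) # q) u"
    using q uw in_arcsD1 by (auto simp: awalk_Cons_iff apath_def)
  moreover have "distinct (tl (pawalk_verts u ((u, w) # q)))"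
    using q by (auto simp: apath_def)
  ultimately have "cycle ((u, w) # q)" unfolding cycle_def by auto
  moreover have "2 \<le> length q"
  proof (rule ccontr)
    assume "\<not> 2 \<le> length q"
    then have "length q = 0 \<or> length q = 1" by linarith
    then consider "q = []" | e where "q = [e]" by (auto simp: length_Suc_conv)
    then show False
    proof cases
      case 1
      then show False using q \<open>u \<noteq> w\<close> by (auto simp: apath_def awalk_Nil_iff)
    next
      case 2
      then have "e = (w, u)" using q by (cases e) (auto simp: apath_def awalk_simps)
      then show False using 2 q avoid by auto
    qed
  qed
  ultimately show False using acyclic by (metis One_nat_def Suc_1 Suc_le_mono length_Cons numeral_3_eq_3)
qed

text \<open>
  A shortest walk from \<open>w\<close> that avoids \<open>u\<close>, continued inside \<open>B\<close> to \<open>u\<close>, would bypass the bridge between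
  \<open>u\<close> and \<open>w\<close>. So it passes through \<open>u\<close>.
\<close>

lemma gdist_new_vertex:
  assumes inner: "\<And>x y. x \<in> B \<Longrightarrow> y \<in> B \<Longrightarrow> \<exists>p. awalk x p y \<and> set p \<subseteq> B \<times> B"
    and B: "B \<subseteq> pverts G" and u: "u \<in> B" and w: "w \<notin> B" and uw: "(u, w) \<in> parcs G"
    and x: "x \<in> B"
  shows "gdist G w x = Suc (gdist G u x)"
proof -
  have V: "u \<in> pverts G" "w \<in> pverts G" "x \<in> pverts G" using uw in_arcsD1 in_arcsD2 x B by auto
  have "gdist G w u = 1" using V uw arcs_symmetric gdist_eq_1_iff by metis
  then have upper: "gdist G w x \<le> Suc (gdist G u x)" using gdist_triangle[of w u x] V by simp
  obtain p where p: "awalk w p x" "length p = gdist G w x" using gdist_awalk V by metis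
  have "u \<in> set (pawalk_verts w p)"
  proof (rule ccontr)
    assume notin: "u \<notin> set (pawalk_verts w p)"
    obtain q where q: "awalk x q u" "set q \<subseteq> B \<times> B" using inner x u by blast
    have ps: "(u, w) \<notin> set p" "(w, u) \<notin> set p"
      using notin set_awalk_verts[OF p(1)] by force+
    show False
      using edge_is_bridge[OF uw, of "p @ q"] p q ps w by auto
  qed
  then obtain q r where qr: "p = q @ r" "awalk w q u" "awalk u r x"
    using awalk_decomp[OF p(1)] that by blast
  have "q \<noteq> []" using qr u w by (auto simp: awalk_Nil_iff)
  then have "1 \<le> length q" by (cases q) auto
  then show ?thesis using gdist_le_length[OF qr(3)] p qr upper by auto
qed

text \<open>
  A largest vertex set that contains \<open>c\<close> and has the property \<open>P\<close> comprises all vertices, because a walk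
  from \<open>c\<close> to a missing vertex would leave the set along some arc.
\<close>

lemma grow_induct [consumes 1, case_names single grow]:
  assumes c: "c \<in> pverts G" and "P {c}"
    and "\<And>B u w. P B \<Longrightarrow> B \<subseteq> pverts G \<Longrightarrow> u \<in> B \<Longrightarrow> w \<notin> B \<Longrightarrow> (u, w) \<in> parcs G \<Longrightarrow> P (insert w B)"
  shows "P (pverts G)"
proof -
  define F where "F = {B. B \<subseteq> pverts G \<and> c \<in> B \<and> P B}"
  have "finite F" unfolding F_def using pair_finite_verts by auto
  moreover have "{c} \<in> F" using assms F_def by auto
  ultimately obtain B where B: "B \<in> F" "\<And>C. C \<in> F \<Longrightarrow> B \<subseteq> C \<Longrightarrow> B = C"
    by (metis finite_has_maximal empty_iff)
  have "B = pverts G"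
  proof (rule ccontr)
    assume "B \<noteq> pverts G"
    then obtain v where v: "v \<in> pverts G" "v \<notin> B" using B F_def by auto
    obtain p where "awalk c p v" using awalk_exists c v by metis
    moreover have "c \<in> B" using B F_def by auto
    ultimately have "\<exists>u w. u \<in> B \<and> w \<notin> B \<and> (u, w) \<in> parcs G"
    proof (induction p arbitrary: c)
      case Nil
      then show ?case using v by (auto simp: awalk_Nil_iff)
    next
      case (Cons e p)
      then show ?case by (cases "snd e \<in> B") (auto simp: awalk_Cons_iff, metis prod.collapse)
    qed
    then obtain u w where uw: "u \<in> B" "w \<notin> B" "(u, w) \<in> parcs G" by blast
    then have "insert w B \<in> F" using B(1) assms(3)[of B u w] in_arcsD2 unfolding F_def by auto
    then show False using B(2) uw by auto
  qed
  then show ?thesis using B F_def by auto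
qed

text \<open>
  Both properties are inherited when the vertex set grows by a neighbour \<open>w\<close> of a vertex \<open>u\<close>: all the
  distances from \<open>w\<close> exceed those from \<open>u\<close> by one. If \<open>w\<close> occurs once among the vertices, it can be
  replaced by \<open>u\<close>; if two of the vertices are equal, the claim is the triangle inequality or trivial.
\<close>

lemma gdist_four_point_even:
  "(\<forall>x\<in>pverts G. \<forall>y\<in>pverts G. \<forall>z\<in>pverts G. \<forall>w\<in>pverts G. gdist G x y + gdist G z w \<le>
      max (gdist G x z + gdist G y w) (gdist G x w + gdist G y z)) \<and>
   (\<forall>x\<in>pverts G. \<forall>y\<in>pverts G. \<forall>z\<in>pverts G. even (gdist G x y + gdist G y z + gdist G z x))"
proof -
  define P where "P = (\<lambda>B.
    (\<forall>x\<in>B. \<forall>y\<in>B. \<exists>p. awalk x p y \<and> set p \<subseteq> B \<times> B) \<and>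
    (\<forall>x\<in>B. \<forall>y\<in>B. \<forall>z\<in>B. \<forall>w\<in>B. gdist G x y + gdist G z w \<le>
      max (gdist G x z + gdist G y w) (gdist G x w + gdist G y z)) \<and>
   (\<forall>x\<in>B. \<forall>y\<in>B. \<forall>z\<in>B. even (gdist G x y + gdist G y z + gdist G z x)))"
  obtain c where c: "c \<in> pverts G" using verts_nonempty by auto
  have "P (pverts G)"
    using c
  proof (induction rule: grow_induct)
    case single
    have "awalk c [] c" using c by (simp add: awalk_Nil_iff)
    then show ?case unfolding P_def using c gdist_eq_0_iff by force
  next
    case (grow B u w)
    have wV: "w \<in> pverts G" using grow in_arcsD2 by auto
    have wu: "(w, u) \<in> parcs G" using grow arcs_symmetric by auto
    have inner: "\<exists>p. awalk x p y \<and> set p \<subseteq> B \<times> B" if "x \<in> B" "y \<in> B" for x y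
      using grow that unfolding P_def by blast
    have fp: "gdist G x y + gdist G z w \<le>
        max (gdist G x z + gdist G y w) (gdist G x w + gdist G y z)"
      if "x \<in> B" "y \<in> B" "z \<in> B" "w \<in> B" for x y z w
      using grow that unfolding P_def by blast
    have ev: "even (gdist G x y + gdist G y z + gdist G z x)" if "x \<in> B" "y \<in> B" "z \<in> B" for x y z
      using grow that unfolding P_def by blast
    have new: "gdist G w x = Suc (gdist G u x)" if "x \<in> B" for x
      using gdist_new_vertex[OF inner grow(2,3,4,5) that] .
    have new': "gdist G x w = Suc (gdist G u x)" if "x \<in> B" for x
      using new[OF that] gdist_commute[of x w] by simp
    have ww: "gdist G w w = 0" using wV gdist_eq_0_iff by auto
    have tri: "gdist G x z \<le> gdist G x y + gdist G y z" if "x \<in> B" "y \<in> B" "z \<in> B" for x y z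
      using that grow(2) gdist_triangle by blast
    have zero: "gdist G x x = 0" if "x \<in> B" for x using that grow(2) gdist_eq_0_iff by blast
    have inner': "\<exists>p. awalk x p y \<and> set p \<subseteq> insert w B \<times> insert w B"
      if xy: "x \<in> insert w B" "y \<in> insert w B" for x y
    proof -
      have nil: "awalk w [] w" using wV by (simp add: awalk_Nil_iff)
      have out: "\<exists>p. awalk w p y \<and> set p \<subseteq> insert w B \<times> insert w B" if yB: "y \<in> B" for y
      proof -
        obtain p where "awalk u p y" "set p \<subseteq> B \<times> B" using inner[OF grow(3) yB] by blast
        then show ?thesis using wu wV grow(3) by (intro exI[of _ "(w, u) # p"]) (auto simp: awalk_simps)
      qed
      have "in": "\<exists>p. awalk x p w \<and> set p \<subseteq> insert w B \<times> insert w B" if xB: "x \<in> B" for x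
      proof -
        obtain p where "awalk x p u" "set p \<subseteq> B \<times> B" using inner[OF xB grow(3)] by blast
        then show ?thesis using grow(5) wV grow(2,3)
          by (intro exI[of _ "p @ [(u, w)]"]) (auto simp: awalk_simps)
      qed
      have mid: "\<exists>p. awalk x p y \<and> set p \<subseteq> insert w B \<times> insert w B" if "x \<in> B" "y \<in> B"
        using inner[OF that] by blast
      show ?thesis
      proof (cases "x = w")
        case True
        then show ?thesis using out xy nil by (cases "y = w") (auto intro!: exI[of _ "[]"])
      next
        case False
        then show ?thesis using "in" mid xy by (cases "y = w") auto
      qed
    qed
    have fp': "gdist G x y + gdist G z t \<le>
        max (gdist G x z + gdist G y t) (gdist G x t + gdist G y z)"
      if m: "x \<in> insert w B" "y \<in> insert w B" "z \<in> insert w B" "t \<in> insert w B" for x y z t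
    proof -
      have uB: "u \<in> B" by fact
      have comm: "gdist G a b = gdist G b a" for a b by (rule gdist_commute)
      have distV: "{x, y, z, t} \<subseteq> pverts G" using m grow(2) wV by blast
      show ?thesis
      proof (cases "distinct [x, y, z, t]")
        case False
        then consider "x = y" | "z = t" | "x = z" | "x = t" | "y = z" | "y = t" by auto
        then show ?thesis
        proof cases
          case 1
          then show ?thesis using gdist_triangle[of z x t] gdist_eq_0_iff[of x x] distV comm[of x z] by simp
        next
          case 2
          then show ?thesis using gdist_triangle[of x z y] gdist_eq_0_iff[of z z] distV comm[of y z] by simp
        next
          case 3
          then show ?thesis using comm[of x y] by simp
        next
          case 4
          then show ?thesis using comm[of x y] comm[of x z] by simp
        next
          case 5
          then show ?thesis using comm[of x y] by simp
        next
          case 6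
          then show ?thesis using comm[of y z] by simp
        qed
      next
        case True
        consider "x = w" | "y = w" | "z = w" | "t = w" | "{x, y, z, t} \<subseteq> B" using m by blast
        then show ?thesis
        proof cases
          case 1
          then have "y \<in> B" "z \<in> B" "t \<in> B" using m True by auto
          then show ?thesis using fp[of u y z t] new uB 1 by simp
        next
          case 2
          then have "x \<in> B" "z \<in> B" "t \<in> B" using m True by auto
          then show ?thesis using fp[of x u z t] new new' comm[of x u] uB 2 by simp
        next
          case 3
          then have "x \<in> B" "y \<in> B" "t \<in> B" using m True by auto
          then show ?thesis using fp[of x y u t] new new' comm[of x u] comm[of y u] uB 3 by simp
        next
          case 4
          then have "x \<in> B" "y \<in> B" "z \<in> B" using m True by auto
          then show ?thesis
            using fp[of x y z u] new' comm[of x u] comm[of y u] comm[of z u] uB 4 by simp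
        next
          case 5
          then show ?thesis using fp by simp
        qed
      qed
    qed
    have ev': "even (gdist G x y + gdist G y z + gdist G z x)"
      if m: "x \<in> insert w B" "y \<in> insert w B" "z \<in> insert w B" for x y z
    proof -
      have uB: "u \<in> B" by fact
      have comm: "gdist G a b = gdist G b a" for a b by (rule gdist_commute)
      have distV: "{x, y, z} \<subseteq> pverts G" using m grow(2) wV by blast
      show ?thesis
      proof (cases "distinct [x, y, z]")
        case False
        then consider "x = y" | "x = z" | "y = z" by auto
        then show ?thesis
        proof cases
          case 1
          then show ?thesis using gdist_eq_0_iff[of x x] distV comm[of z x] by simp
        next
          case 2
          then show ?thesis using gdist_eq_0_iff[of z z] distV comm[of y z] by simp
        next
          case 3
          then show ?thesis using gdist_eq_0_iff[of z z] distV comm[of x z] by simp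
        qed
      next
        case True
        consider "x = w" | "y = w" | "z = w" | "{x, y, z} \<subseteq> B" using m by blast
        then show ?thesis
        proof cases
          case 1
          then have "y \<in> B" "z \<in> B" using m True by auto
          then show ?thesis using ev[of u y z] new new' comm[of z u] uB 1 by simp
        next
          case 2
          then have "x \<in> B" "z \<in> B" using m True by auto
          then show ?thesis using ev[of x u z] new new' comm[of x u] uB 2 by simp
        next
          case 3
          then have "x \<in> B" "y \<in> B" using m True by auto
          then show ?thesis using ev[of x y u] new new' comm[of y u] uB 3 by simp
        next
          case 4
          then show ?thesis using ev by simp
        qed
      qed
    qed
    show ?case unfolding P_def by (intro conjI ballI inner' fp' ev')
  qed
  then show ?thesis unfolding P_def by (elim conjE) (intro conjI)
qed

sublocale tree_metric "pverts G" "gdist G"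
proof
  show "finite (pverts G)" by (rule pair_finite_verts)
  show "pverts G \<noteq> {}" by (rule verts_nonempty)
qed (use gdist_eq_0_iff gdist_commute gdist_four_point_even gdist_geodesic in \<open>auto\<close>)

end

lemma undirected_tree_iff_tree_graph: "undirected_tree G \<longleftrightarrow> tree_graph G"
  unfolding undirected_tree_def tree_graph_def tree_graph_axioms_def by blast

lemma isomorphicI:
  assumes "pair_graph G" and "pair_graph H"
    and bij: "bij_betw \<phi> (pverts G) (pverts H)"
    and arcs: "\<And>x y. x \<in> pverts G \<Longrightarrow> y \<in> pverts G \<Longrightarrow> (x, y) \<in> parcs G \<longleftrightarrow> (\<phi> x, \<phi> y) \<in> parcs H"
  shows "isomorphic G H"
proof -
  interpret G: pair_graph G by fact
  interpret H: pair_graph H by fact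
  define f where "f = \<lparr>iso_verts = \<phi>, iso_arcs = map_prod \<phi> \<phi>, iso_head = snd, iso_tail = fst\<rparr>"
  have inj: "inj_on \<phi> (pverts G)" and img: "\<phi> ` pverts G = pverts H"
    using bij by (auto simp: bij_betw_def)
  have "inj_on (map_prod \<phi> \<phi>) (parcs G)"
  proof (rule inj_on_subset[OF map_prod_inj_on[OF inj inj]])
    show "parcs G \<subseteq> pverts G \<times> pverts G" using G.in_arcsD1 G.in_arcsD2 by auto
  qed
  then have "G.digraph_isomorphism f"
    unfolding G.digraph_isomorphism_def f_def using inj G.wf_digraph_axioms by auto
  moreover have "map_prod \<phi> \<phi> ` parcs G = parcs H"
  proof (intro equalityI subsetI)
    fix e assume "e \<in> map_prod \<phi> \<phi> ` parcs G"
    then obtain x y where "(x, y) \<in> parcs G" "e = (\<phi> x, \<phi> y)" by auto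
    then show "e \<in> parcs H" using arcs[of x y] G.in_arcsD1[of x y] G.in_arcsD2[of x y] by simp
  next
    fix e assume e: "e \<in> parcs H"
    obtain a b where ab: "e = (a, b)" by (cases e)
    then have "a \<in> \<phi> ` pverts G" "b \<in> \<phi> ` pverts G"
      using e H.in_arcsD1 H.in_arcsD2 img by auto
    then obtain x y where "x \<in> pverts G" "a = \<phi> x" "y \<in> pverts G" "b = \<phi> y" by auto
    then show "e \<in> map_prod \<phi> \<phi> ` parcs G" using arcs[of x y] e ab by force
  qed
  then have "with_proj H = app_iso f (with_proj G)"
    unfolding app_iso_def f_def with_proj_def using img by simp
  ultimately show ?thesis unfolding isomorphic_def digraph_iso_def by blast
qed

section \<open>Eccentric sequences and vertex pairs\<close>

context tree_graph
begin

lemma eccentricity_eq: "eccentricity G = ecc"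
  by (simp add: fun_eq_iff eccentricity_def ecc_def)

lemma graph_diameter_eq: "graph_diameter G = diam"
proof -
  have "{gdist G u v | u v. u \<in> pverts G \<and> v \<in> pverts G} = (\<lambda>(u, v). gdist G u v) ` (pverts G \<times> pverts G)"
    by auto
  then have "finite {gdist G u v | u v. u \<in> pverts G \<and> v \<in> pverts G}" using finite_V by simp
  then show ?thesis
    unfolding graph_diameter_def
    by (rule Max_eqI) (use d_le_diam diam_attained in \<open>auto, metis\<close>)
qed

lemma count_eccentric_sequence: "count_list (eccentric_sequence G) p = card (level p)"
proof -
  have "count_list (eccentric_sequence G) p = count (mset (eccentric_sequence G)) p"
    by (simp add: count_mset)
  also have "\<dots> = card {x \<in> pverts G. p = ecc x}"
    using finite_V
    by (simp add: eccentric_sequence_def count_image_mset' eccentricity_eq del: mset_map)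
  finally show ?thesis by (simp add: level_def eq_commute)
qed

lemma set_eccentric_sequence: "set (eccentric_sequence G) = {(diam + 1) div 2..diam}"
proof -
  have "set (eccentric_sequence G) = {p. level p \<noteq> {}}"
    using finite_V by (auto simp: eccentric_sequence_def eccentricity_eq level_def)
  also have "\<dots> = {(diam + 1) div 2..diam}" by (auto simp: level_nonempty_iff)
  finally show ?thesis .
qed

text \<open>
  Every number from the radius \<open>(diam + 1) div 2\<close> to \<open>diam\<close> occurs as an eccentricity.
\<close>

lemma short_form_eccentric_sequence:
  "short_form (eccentric_sequence G) =
    ((diam + 1) div 2, map (\<lambda>p. card (level p)) [(diam + 1) div 2 + 1..<diam + 1])"
proof -
  have "sorted_list_of_set (set (eccentric_sequence G)) = [(diam + 1) div 2..<diam + 1]"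
    unfolding set_eccentric_sequence
    by (metis Suc_eq_plus1 atLeastLessThanSuc_atLeastAtMost sorted_list_of_set_range)
  moreover have "(diam + 1) div 2 < diam + 1" by simp
  ultimately show ?thesis
    unfolding short_form_def Let_def
    by (simp add: upt_rec[of "(diam + 1) div 2"] count_eccentric_sequence fun_eq_iff del: upt_Suc)
qed

text \<open>
  Ordered pairs are easier to sort by level. The diagonal contributes a constant that depends on the
  number of vertices only.
\<close>

lemma sum_vertex_pairs:
  fixes f :: "nat \<Rightarrow> real"
  shows "(\<Sum>x\<in>pverts G. \<Sum>y\<in>pverts G. f (gdist G x y)) =
    real (card (pverts G)) * f 0 + 2 * (\<Sum>e\<in>vertex_pairs G. f (pair_dist G e))"
proof -
  define V where "V = pverts G"
  define P where "P = {(x, y). x \<in> V \<and> y \<in> V \<and> x \<noteq> y}"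
  have fin: "finite V" unfolding V_def by (rule finite_V)
  have finP: "finite P" unfolding P_def using fin by (auto intro: finite_subset[of _ "V \<times> V"])
  have "(\<Sum>x\<in>V. \<Sum>y\<in>V. f (gdist G x y)) = (\<Sum>(x, y)\<in>V \<times> V. f (gdist G x y))"
    by (rule sum.cartesian_product)
  also have "V \<times> V = (\<lambda>x. (x, x)) ` V \<union> P" unfolding P_def by auto
  also have "(\<Sum>(x, y)\<in>\<dots>. f (gdist G x y)) =
      (\<Sum>(x, y)\<in>(\<lambda>x. (x, x)) ` V. f (gdist G x y)) + (\<Sum>(x, y)\<in>P. f (gdist G x y))"
    using fin finP by (intro sum.union_disjoint) (auto simp: P_def)
  also have "(\<Sum>(x, y)\<in>(\<lambda>x. (x, x)) ` V. f (gdist G x y)) = (\<Sum>x\<in>V. f 0)"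
    by (subst sum.reindex) (auto simp: inj_on_def V_def d_self)
  also have "(\<Sum>(x, y)\<in>P. f (gdist G x y)) =
      (\<Sum>e\<in>vertex_pairs G. \<Sum>(x, y)\<in>{z \<in> P. {fst z, snd z} = e}. f (gdist G x y))"
  proof (rule sum.group[symmetric])
    show "finite (vertex_pairs G)" unfolding vertex_pairs_def using finite_V by simp
    show "(\<lambda>z. {fst z, snd z}) ` P \<subseteq> vertex_pairs G"
      unfolding vertex_pairs_def P_def V_def by auto
  qed (rule finP)
  also have "\<dots> = (\<Sum>e\<in>vertex_pairs G. 2 * f (pair_dist G e))"
  proof (rule sum.cong)
    fix e assume "e \<in> vertex_pairs G"
    then obtain u v where uv: "e = {u, v}" "u \<noteq> v" "u \<in> V" "v \<in> V"
      unfolding vertex_pairs_def V_def by (auto simp: card_2_iff)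
    then have "{z \<in> P. {fst z, snd z} = e} = {(u, v), (v, u)}"
      unfolding P_def by (auto simp: doubleton_eq_iff)
    then show "(\<Sum>(x, y)\<in>{z \<in> P. {fst z, snd z} = e}. f (gdist G x y)) = 2 * f (pair_dist G e)"
      using uv gdist_commute[of v u] by (simp add: pair_dist_eq)
  qed simp
  finally show ?thesis by (simp add: V_def sum_distrib_left)
qed

lemma length_eccentric_sequence: "length (eccentric_sequence G) = card (pverts G)"
  unfolding eccentric_sequence_def
  by (metis mset_sorted_list_of_multiset size_image_mset size_mset size_mset_set)

lemma diam_eq_Max: "diam = Max (set (eccentric_sequence G))"
proof -
  have "Max {(diam + 1) div 2..diam} = diam" by (intro Max_eqI) auto
  then show ?thesis by (simp only: set_eccentric_sequence)
qed

end

section \<open>The extremal tree\<close>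

text \<open>
  The diameter is going to be \<open>r + length ms\<close>, and the bounds on \<open>length ms\<close> say that \<open>r\<close> is then the
  radius.
\<close>

locale extremal_params =
  fixes r :: nat and ms :: "nat list"
  assumes len: "length ms \<le> r" "r \<le> length ms + 1"
    and two_le: "\<And>i. i < length ms \<Longrightarrow> 2 \<le> ms ! i"
begin

abbreviation D :: nat where
  "D \<equiv> r + length ms"

abbreviation E :: "extremal_vertex pair_pre_digraph" where
  "E \<equiv> extremal_tree r ms"

text \<open>
  The vertex of the path that is \<open>x\<close> itself or carries the pendent vertex \<open>x\<close>.
\<close>

definition foot :: "extremal_vertex \<Rightarrow> nat" where
  "foot x = (case x of Path k \<Rightarrow> k | Pendent j i \<Rightarrow> length ms + 2 - j)"

definition stalk :: "extremal_vertex \<Rightarrow> nat" where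
  "stalk x = (case x of Path k \<Rightarrow> 0 | Pendent j i \<Rightarrow> 1)"

definition dist_E :: "extremal_vertex \<Rightarrow> extremal_vertex \<Rightarrow> nat" where
  "dist_E x y = (if x = y then 0 else (foot x - foot y) + (foot y - foot x) + stalk x + stalk y)"

lemma foot_simps [simp]: "foot (Path k) = k" "foot (Pendent j i) = length ms + 2 - j"
  by (simp_all add: foot_def)

lemma stalk_simps [simp]: "stalk (Path k) = 0" "stalk (Pendent j i) = 1"
  by (simp_all add: stalk_def)

lemma verts_E [simp]:
  "Path k \<in> pverts E \<longleftrightarrow> k \<le> D"
  "Pendent j i \<in> pverts E \<longleftrightarrow> 2 \<le> j \<and> j \<le> length ms + 1 \<and> i < ms ! (j - 2) - 2"
  by (auto simp: extremal_tree_def Let_def)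

lemma arcs_E [simp]:
  "(Path k, Path k') \<in> parcs E \<longleftrightarrow> (k' = Suc k \<and> k < D) \<or> (k = Suc k' \<and> k' < D)"
  "(Path k, Pendent j i) \<in> parcs E \<longleftrightarrow> Pendent j i \<in> pverts E \<and> k = length ms + 2 - j"
  "(Pendent j i, Path k) \<in> parcs E \<longleftrightarrow> Pendent j i \<in> pverts E \<and> k = length ms + 2 - j"
  "(Pendent j i, Pendent j' i') \<notin> parcs E"
  by (auto simp: extremal_tree_def Let_def)

lemma arc_E_in_verts:
  assumes "(x, y) \<in> parcs E"
  shows "x \<in> pverts E" "y \<in> pverts E" "(y, x) \<in> parcs E" "x \<noteq> y"
  using assms by (cases x; cases y; auto)+

lemma finite_verts_E: "finite (pverts E)"
proof -
  have "pverts E \<subseteq> Path ` {..D} \<union>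
      (\<lambda>(j, i). Pendent j i) ` Sigma {2..length ms + 1} (\<lambda>j. {..<ms ! (j - 2) - 2})"
  proof
    fix x assume "x \<in> pverts E"
    then show "x \<in> Path ` {..D} \<union>
      (\<lambda>(j, i). Pendent j i) ` Sigma {2..length ms + 1} (\<lambda>j. {..<ms ! (j - 2) - 2})"
      by (cases x) auto
  qed
  moreover have "finite (Sigma {2..length ms + 1} (\<lambda>j. {..<ms ! (j - 2) - 2}))"
    by (rule finite_SigmaI) auto
  ultimately show ?thesis by (meson finite_UnI finite_atMost finite_imageI finite_subset)
qed

lemma pair_graph_E: "pair_graph E"
proof unfold_locales
  show "finite (pverts E)" by (rule finite_verts_E)
  have "parcs E \<subseteq> pverts E \<times> pverts E" using arc_E_in_verts by auto
  then show "finite (parcs E)" using finite_verts_E by (meson finite_SigmaI finite_subset)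
  show "symmetric (with_proj E)" unfolding symmetric_def using arc_E_in_verts(3) by (auto intro: symI)
  fix e assume "e \<in> parcs E"
  then have "(fst e, snd e) \<in> parcs E" by simp
  then show "fst e \<in> pverts E" "snd e \<in> pverts E" "fst e \<noteq> snd e" using arc_E_in_verts by blast+
qed

lemma foot_le: "x \<in> pverts E \<Longrightarrow> foot x \<le> D"
  by (cases x) auto

lemma dist_E_step:
  assumes "x \<in> pverts E" "(y, y') \<in> parcs E"
  shows "dist_E x y' \<le> Suc (dist_E x y)"
  using assms by (cases y; cases y') (auto simp: dist_E_def)

lemma dist_E_descent:
  assumes x: "x \<in> pverts E" and y: "y \<in> pverts E" and "x \<noteq> y"
  shows "\<exists>y'. (y', y) \<in> parcs E \<and> dist_E x y = Suc (dist_E x y')"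
proof (cases y)
  case (Pendent j i)
  then show ?thesis
    using assms by (intro exI[of _ "Path (foot y)"]) (cases x; auto simp: dist_E_def)
next
  case (Path k)
  consider "foot x = k" | "foot x < k" | "k < foot x" by linarith
  then show ?thesis
  proof cases
    case 1
    then show ?thesis
      using assms Path by (intro exI[of _ x]) (cases x; auto simp: dist_E_def)
  next
    case 2
    then show ?thesis
      using assms Path by (intro exI[of _ "Path (k - 1)"]) (cases x; auto simp: dist_E_def)
  next
    case 3
    then show ?thesis
      using assms Path foot_le[OF x] by (intro exI[of _ "Path (Suc k)"]) (cases x; auto simp: dist_E_def)
  qed
qed

lemma gdist_E:
  assumes "x \<in> pverts E" "y \<in> pverts E"
  shows "gdist E x y = dist_E x y" and "\<exists>p. pre_digraph.awalk (with_proj E) x p y"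
proof -
  interpret pair_graph E by (rule pair_graph_E)
  have refl: "dist_E x x = 0" for x by (simp add: dist_E_def)
  show "gdist E x y = dist_E x y" "\<exists>p. awalk x p y"
    using gdist_eqI[of dist_E, OF refl dist_E_step dist_E_descent assms] by blast+
qed

lemma tree_graph_E: "tree_graph E"
proof -
  interpret pair_graph E by (rule pair_graph_E)
  show ?thesis
  proof unfold_locales
    have "Path 0 \<in> pverts E" by simp
    then show "connected (with_proj E)" using gdist_E(2) by (intro connectedI_awalk) blast+
    show "\<not> (\<exists>p. cycle p \<and> 3 \<le> length p)"
    proof (rule no_long_cycle)
      fix x y y'
      assume "(x, y) \<in> parcs E" "(x, y') \<in> parcs E"
        "foot y + stalk y \<le> foot x + stalk x" "foot y' + stalk y' \<le> foot x + stalk x"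
      then show "y = y'" by (cases x; cases y; cases y') auto
    qed
  qed
qed

sublocale tree_graph E
  by (rule tree_graph_E)

lemma diam_E: "diam = D"
proof -
  have "dist_E (Path 0) (Path D) = D" by (simp add: dist_E_def)
  then have "D \<le> diam" using d_le_diam[of "Path 0" "Path D"] gdist_E(1)[of "Path 0" "Path D"] by simp
  moreover have "dist_E x y \<le> D" if "x \<in> pverts E" "y \<in> pverts E" for x y
    using that len by (cases x; cases y) (auto simp: dist_E_def)
  then have "diam \<le> D" using diam_attained gdist_E(1) by metis
  ultimately show ?thesis by simp
qed

lemma ecc_E:
  assumes "x \<in> pverts E"
  shows "ecc x = max (dist_E x (Path 0)) (dist_E x (Path D))"
proof -
  interpret tree_diameter "pverts E" "gdist E" "Path 0" "Path D"
    using gdist_E(1)[of "Path 0" "Path D"] by unfold_locales (auto simp: diam_E dist_E_def)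
  show ?thesis using ecc_ends[OF assms] gdist_E(1)[OF assms] by simp
qed

lemma ecc_Path: "k \<le> D \<Longrightarrow> ecc (Path k) = max k (D - k)"
  using ecc_E[of "Path k"] by (auto simp: dist_E_def)

lemma ecc_Pendent: "Pendent j i \<in> pverts E \<Longrightarrow> ecc (Pendent j i) = r + j - 1"
  using ecc_E[of "Pendent j i"] len by (auto simp: dist_E_def)

lemma level_E:
  assumes "r < p" "p \<le> D"
  shows "level p = {Path p, Path (D - p)} \<union> Pendent (p + 1 - r) ` {..<ms ! (p - r - 1) - 2}"
proof (intro equalityI subsetI)
  fix x assume x: "x \<in> level p"
  show "x \<in> {Path p, Path (D - p)} \<union> Pendent (p + 1 - r) ` {..<ms ! (p - r - 1) - 2}"
  proof (cases x)
    case (Path k)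
    then have "k \<le> D" "max k (D - k) = p" using levelD[OF x] ecc_Path[of k] by auto
    then have "k = p \<or> k = D - p" by linarith
    then show ?thesis using Path by auto
  next
    case (Pendent j i)
    then have ji: "Pendent j i \<in> pverts E" "r + j - 1 = p" using levelD[OF x] ecc_Pendent[of j i] by auto
    then have "j = p + 1 - r" "j - 2 = p - r - 1" using assms by auto
    then show ?thesis using Pendent ji(1) by auto
  qed
next
  fix x assume x: "x \<in> {Path p, Path (D - p)} \<union> Pendent (p + 1 - r) ` {..<ms ! (p - r - 1) - 2}"
  show "x \<in> level p"
  proof (cases x)
    case (Path k)
    then have "k = p \<or> k = D - p" using x by auto
    then show ?thesis using Path assms len ecc_Path[of k] by (auto simp: level_def)
  next
    case (Pendent j i)
    then have "j = p + 1 - r" "i < ms ! (p - r - 1) - 2" using x by auto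
    moreover have "p + 1 - r - 2 = p - r - 1" by simp
    ultimately have V: "Pendent j i \<in> pverts E" using assms by auto
    then show ?thesis using Pendent ecc_Pendent[OF V] \<open>j = p + 1 - r\<close> assms by (simp add: level_def)
  qed
qed

lemma card_level_E:
  assumes "r < p" "p \<le> D"
  shows "card (level p) = ms ! (p - r - 1)"
proof -
  have "card (Pendent (p + 1 - r) ` {..<ms ! (p - r - 1) - 2}) = ms ! (p - r - 1) - 2"
    by (subst card_image) (auto simp: inj_on_def)
  moreover have "card {Path p, Path (D - p)} = 2" using assms len by auto
  ultimately have "card (level p) = 2 + (ms ! (p - r - 1) - 2)"
    unfolding level_E[OF assms] by (subst card_Un_disjoint) auto
  moreover have "p - r - 1 < length ms" using assms by linarith
  then have "2 \<le> ms ! (p - r - 1)" by (rule two_le)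
  ultimately show ?thesis by linarith
qed

text \<open>
  At each level above the middle, all vertices other than \<open>Path p\<close> are the path vertex \<open>Path (D - p)\<close> or
  pendent vertices at its neighbour \<open>Path (D + 1 - p)\<close>.
\<close>

lemma foot_level:
  assumes "D < 2 * p" "p \<le> D" "x \<in> level p" "x \<noteq> Path p"
  shows "foot x + p = D + stalk x"
proof (cases x)
  case (Path k)
  then have "k \<le> D" "max k (D - k) = p" "k \<noteq> p" using levelD[OF assms(3)] ecc_Path[of k] assms by auto
  then show ?thesis using Path by auto
next
  case (Pendent j i)
  then have "Pendent j i \<in> pverts E" "r + j - 1 = p" using levelD[OF assms(3)] ecc_Pendent[of j i] by auto
  then show ?thesis using Pendent by auto
qed

lemma stalk_le: "stalk x \<le> 1"
  by (cases x) auto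

text \<open>
  The vertices \<open>Path p\<close> with \<open>D < 2 * p\<close> form a branch that is a bare path.
\<close>

lemma pair_sum_E_le:
  assumes mono: "mono f" and p: "D < 2 * p" "p \<le> q" "q \<le> D"
  shows "pair_sum f p q \<le> pair_bound D p q (card (level p)) (card (level q)) f"
  unfolding diam_E[symmetric]
proof (rule pair_sum_le_bound[OF mono])
  show "diam < 2 * p" "p \<le> q" using p diam_E by auto
  have V: "Path p \<in> pverts E" "Path q \<in> pverts E" using p by auto
  show L: "Path p \<in> level p" "Path q \<in> level q" using p ecc_Path by (auto simp: level_def)
  show "gdist E (Path p) (Path q) = q - p" using gdist_E(1)[OF V] p by (simp add: dist_E_def)
  {
    fix y assume y: "y \<in> level q" "y \<noteq> Path q"
    have yV: "y \<in> pverts E" using y levelD by blast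
    have "foot y + q = D + stalk y" using foot_level[OF _ _ y] p by simp
    moreover have "y \<noteq> Path p"
    proof
      assume "y = Path p"
      then have "p = q" using levelD(2)[OF y(1)] levelD(2)[OF L(1)] by simp
      then show False using y \<open>y = Path p\<close> by simp
    qed
    moreover have "stalk y \<le> 1" by (rule stalk_le)
    ultimately show "gdist E (Path p) y = p + q - diam"
      using gdist_E(1)[OF V(1) yV] p unfolding diam_E by (simp add: dist_E_def)
  }
  {
    fix x y assume x: "x \<in> level p" "x \<noteq> Path p" and y: "y \<in> level q" "y \<noteq> Path q"
    have V': "x \<in> pverts E" "y \<in> pverts E" using x y levelD by blast+
    have "foot x + p = D + stalk x" using foot_level[OF _ _ x] p by simp
    moreover have "foot y + q = D + stalk y" using foot_level[OF _ _ y] p by simp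
    moreover have "stalk x \<le> 1" "stalk y \<le> 1" by (rule stalk_le)+
    ultimately show "gdist E x y \<le> q - p + 2"
      unfolding gdist_E(1)[OF V'] dist_E_def using p by (cases "x = y"; simp; linarith)
  }
qed

end

section \<open>Minimality and uniqueness\<close>

context extremal_params
begin

context
  fixes T :: "'a pair_pre_digraph" and f :: "nat \<Rightarrow> real"
  assumes T: "tree_graph T" and same_sequence: "eccentric_sequence T = eccentric_sequence E"
    and mono: "strict_mono f"
begin

interpretation T: tree_graph T by (rule T)

lemma T_diam: "T.diam = D"
  using T.diam_eq_Max diam_eq_Max same_sequence diam_E by simp

lemma T_card_level: "card (T.level p) = card (level p)"
  using T.count_eccentric_sequence[of p] count_eccentric_sequence[of p] same_sequence by simp

lemma T_card_verts: "card (pverts T) = card (pverts E)"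
  using T.length_eccentric_sequence length_eccentric_sequence same_sequence by simp

lemma pair_sum_le:
  assumes "p \<le> D" "q \<le> D"
  shows "pair_sum f p q \<le> T.pair_sum f p q"
proof -
  have ordered: "pair_sum f p q \<le> T.pair_sum f p q" if pq: "p \<le> q" "q \<le> D" for p q
  proof -
    consider "2 * p < D" | "2 * p = D" | "D < 2 * p" by linarith
    then show ?thesis
    proof cases
      case 1
      then have "level p = {}" "T.level p = {}"
        using level_nonempty_iff[of p] T.level_nonempty_iff[of p] diam_E T_diam by auto
      then show ?thesis by (simp add: pair_sum_def T.pair_sum_def)
    next
      case 2
      then have "card (level p) = 1" using card_central_level[of p] diam_E by simp
      then show ?thesis
        using pair_sum_central[of p q f] T.pair_sum_central[of p q f] 2 pq diam_E T_diam T_card_level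
        by simp
    next
      case 3
      have "pair_sum f p q \<le> pair_bound D p q (card (level p)) (card (level q)) f"
        using pair_sum_E_le strict_mono_mono[OF mono] 3 pq by blast
      also have "\<dots> \<le> T.pair_sum f p q"
        using T.pair_sum_ge_bound(1)[OF mono, of p q] 3 pq T_diam T_card_level by simp
      finally show ?thesis .
    qed
  qed
  show ?thesis
    using ordered[of p q] ordered[of q p] assms pair_sum_commute T.pair_sum_commute
    by (metis nat_le_linear)
qed

lemma total_sum_le:
  "(\<Sum>x\<in>pverts E. \<Sum>y\<in>pverts E. f (gdist E x y)) \<le> (\<Sum>x\<in>pverts T. \<Sum>y\<in>pverts T. f (gdist T x y))"
  unfolding sum_by_levels T.sum_by_levels diam_E T_diam
  by (intro sum_mono pair_sum_le) auto

text \<open>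
  The map that sends the path to the path \<open>w\<close> in \<open>T\<close>, and the pendent vertices of each level to the
  vertices of \<open>T\<close> at this level that are off the path, keeps the distances along the path and from each
  vertex to its foot. By the triangle inequality it does not increase any distance, and the equality of
  the sums leaves no room for a decrease. This saves the computation of all distances in \<open>T\<close>.
\<close>

lemma caterpillar_isomorphic:
  assumes td: "tree_diameter (pverts T) (gdist T) a b"
    and cat: "\<And>x. x \<in> pverts T \<Longrightarrow> x \<notin> tree_diameter.spine (pverts T) (gdist T) a b ` {..D} \<Longrightarrow>
      gdist T x (tree_diameter.spine (pverts T) (gdist T) a b (D + 1 - T.ecc x)) = 1"
    and eq: "(\<Sum>x\<in>pverts T. \<Sum>y\<in>pverts T. f (gdist T x y)) =
      (\<Sum>x\<in>pverts E. \<Sum>y\<in>pverts E. f (gdist E x y))"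
  shows "isomorphic T E"
proof -
  interpret td: tree_diameter "pverts T" "gdist T" a b by (rule td)
  define w where "w = td.spine"
  define N where "N = (\<lambda>j. T.level (r + j - 1) - w ` {..D})"
  have card_N: "card (N j) = ms ! (j - 2) - 2" if j: "2 \<le> j" "j \<le> length ms + 1" for j
  proof -
    define p where "p = r + j - 1"
    have p: "r < p" "p \<le> D" "D < 2 * p" "p - r - 1 = j - 2" using j len unfolding p_def by auto
    have "card (T.level p \<inter> w ` {..D}) = 2"
      using td.level_on_spine[of p] td.same_branch_ends_spine(5)[of p] p T_diam unfolding w_def by simp
    then show ?thesis
      using card_Diff_subset_Int[of "T.level p" "w ` {..D}"] T.finite_level[of p]
        T_card_level[of p] card_level_E[OF p(1,2)] p(4)
      unfolding N_def p_def by simp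
  qed
  have "\<exists>h. bij_betw h {..<card (N j)} (N j)" for j
    using ex_bij_betw_nat_finite[of "N j"] T.finite_level by (simp add: N_def lessThan_atLeast0)
  then obtain g where g: "\<And>j. bij_betw (g j) {..<card (N j)} (N j)" by metis
  define \<phi> where "\<phi> = (\<lambda>x. case x of Path k \<Rightarrow> w k | Pendent j i \<Rightarrow> g j i)"
  have Path: "\<phi> (Path k) = w k" and Pendent: "\<phi> (Pendent j i) = g j i" for j i k
    by (simp_all add: \<phi>_def)
  have w: "w k \<in> pverts T" if "k \<le> D" for k using td.spine(1)[of k] that T_diam w_def by simp
  have g_N: "g j i \<in> N j" if "Pendent j i \<in> pverts E" for j i
  proof -
    have "i \<in> {..<card (N j)}" using that card_N by simp
    then show ?thesis using bij_betwE[OF g[of j]] by blast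
  qed
  have d_w: "gdist T (w i) (w j) = (if i \<le> j then j - i else i - j)" if "i \<le> D" "j \<le> D" for i j
    using td.d_spine[of i j] that T_diam w_def by simp
  have \<phi>_V: "\<phi> x \<in> pverts T" if "x \<in> pverts E" for x
    using that w g_N by (cases x) (auto simp: Path Pendent N_def T.level_def)
  have \<phi>_foot: "gdist T (\<phi> x) (w (foot x)) = stalk x" if x: "x \<in> pverts E" for x
  proof (cases x)
    case (Path k)
    then show ?thesis using x w T.d_self \<open>\<And>k. \<phi> (Path k) = w k\<close> by simp
  next
    case (Pendent j i)
    have "g j i \<in> N j" using g_N x Pendent by simp
    then have "g j i \<in> pverts T" "T.ecc (g j i) = r + j - 1" "g j i \<notin> w ` {..D}"
      by (auto simp: N_def T.level_def)
    moreover have "D + 1 - (r + j - 1) = foot x" using Pendent x by auto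
    ultimately show ?thesis using cat[of "g j i"] Pendent by (simp add: \<phi>_def w_def)
  qed
  have inj: "inj_on \<phi> (pverts E)"
  proof (rule inj_onI)
    fix x y assume x: "x \<in> pverts E" and y: "y \<in> pverts E" and xy: "\<phi> x = \<phi> y"
    have path: "\<phi> (Path k) \<in> w ` {..D}" if "k \<le> D" for k using that by (simp add: Path)
    have pend: "\<phi> (Pendent j i) \<notin> w ` {..D}" "T.ecc (\<phi> (Pendent j i)) = r + j - 1"
      if "Pendent j i \<in> pverts E" for j i
      using g_N[OF that] by (auto simp: Pendent N_def T.level_def)
    show "x = y"
    proof (cases x; cases y)
      fix k k' assume k: "x = Path k" "y = Path k'"
      then have "gdist T (w k) (w k') = 0" using xy x w[of k] T.d_self[of "w k"] by (simp add: Path)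
      then show ?thesis using d_w[of k k'] k x y by (simp split: if_splits)
    next
      fix k j i assume kji: "x = Path k" "y = Pendent j i"
      then have "k \<le> D" "Pendent j i \<in> pverts E" using x y by simp_all
      then have "\<phi> (Path k) \<noteq> \<phi> (Pendent j i)" using path[of k] pend(1)[of j i] by metis
      then show ?thesis using xy kji by simp
    next
      fix k j i assume kji: "x = Pendent j i" "y = Path k"
      then have "k \<le> D" "Pendent j i \<in> pverts E" using x y by simp_all
      then have "\<phi> (Path k) \<noteq> \<phi> (Pendent j i)" using path[of k] pend(1)[of j i] by metis
      then show ?thesis using xy kji by simp
    next
      fix j i j' i' assume ji: "x = Pendent j i" "y = Pendent j' i'"
      then have "r + j - 1 = r + j' - 1" using pend(2) xy x y by metis
      then have j: "j = j'" using x y ji by auto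
      have "i \<in> {..<card (N j)}" "i' \<in> {..<card (N j)}" using x y ji j card_N by auto
      then have "i = i'" using bij_betw_imp_inj_on[OF g[of j]] xy ji j by (auto simp: Pendent inj_on_def)
      then show ?thesis using ji j by simp
    qed
  qed
  have "\<phi> ` pverts E = pverts T"
  proof (rule card_subset_eq[OF T.finite_V])
    show "\<phi> ` pverts E \<subseteq> pverts T" using \<phi>_V by blast
    show "card (\<phi> ` pverts E) = card (pverts T)" using card_image[OF inj] T_card_verts by simp
  qed
  with inj have bij: "bij_betw \<phi> (pverts E) (pverts T)" by (simp add: bij_betw_def)
  have le: "gdist T (\<phi> x) (\<phi> y) \<le> gdist E x y" if x: "x \<in> pverts E" and y: "y \<in> pverts E" for x y
  proof (cases "x = y")
    case True
    then show ?thesis using T.d_self \<phi>_V x by simp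
  next
    case False
    have V: "w (foot x) \<in> pverts T" "w (foot y) \<in> pverts T" "\<phi> x \<in> pverts T" "\<phi> y \<in> pverts T"
      using w foot_le \<phi>_V x y by auto
    have "gdist T (\<phi> x) (\<phi> y) \<le> gdist T (\<phi> x) (w (foot x)) + gdist T (w (foot x)) (\<phi> y)"
      "gdist T (w (foot x)) (\<phi> y) \<le> gdist T (w (foot x)) (w (foot y)) + gdist T (w (foot y)) (\<phi> y)"
      using T.triangle V by blast+
    moreover have "gdist T (w (foot y)) (\<phi> y) = gdist T (\<phi> y) (w (foot y))"
      by (rule T.gdist_commute)
    ultimately have "gdist T (\<phi> x) (\<phi> y) \<le> stalk x + gdist T (w (foot x)) (w (foot y)) + stalk y"
      using \<phi>_foot[OF x] \<phi>_foot[OF y] by linarith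
    then show ?thesis
      using d_w[OF foot_le[OF x] foot_le[OF y]] gdist_E(1)[OF x y] False
      by (simp add: dist_E_def split: if_splits)
  qed
  have "gdist T (\<phi> x) (\<phi> y) = gdist E x y" if x: "x \<in> pverts E" and y: "y \<in> pverts E" for x y
  proof -
    have f_le: "f (gdist T (\<phi> x) (\<phi> y)) \<le> f (gdist E x y)"
      if "x \<in> pverts E" "y \<in> pverts E" for x y
      using strict_mono_mono[OF mono] le[OF that] by (rule monoD)
    have "(\<Sum>x\<in>pverts E. \<Sum>y\<in>pverts E. f (gdist T (\<phi> x) (\<phi> y))) =
        (\<Sum>x\<in>pverts E. \<Sum>y\<in>pverts E. f (gdist E x y))"
      unfolding eq[symmetric]
        sum.reindex_bij_betw[OF bij, of "\<lambda>u. \<Sum>v\<in>pverts T. f (gdist T u v)", symmetric]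
        sum.reindex_bij_betw[OF bij, of "\<lambda>v. f (gdist T (\<phi> _) v)", symmetric] ..
    then have "(\<Sum>y\<in>pverts E. f (gdist T (\<phi> x) (\<phi> y))) = (\<Sum>y\<in>pverts E. f (gdist E x y))"
      by (rule sum_mono_inv) (auto intro: sum_mono f_le x finite_V)
    then have "f (gdist T (\<phi> x) (\<phi> y)) = f (gdist E x y)"
      by (rule sum_mono_inv) (auto intro: f_le x y finite_V)
    then show ?thesis using strict_mono_eq[OF mono] by simp
  qed
  note isometry = this
  define \<psi> where "\<psi> = inv_into (pverts E) \<phi>"
  have \<psi>: "\<psi> x \<in> pverts E" "\<phi> (\<psi> x) = x" if "x \<in> pverts T" for x
    using bij_betw_inv_into_right[OF bij that] bij_betwE[OF bij_betw_inv_into[OF bij]] that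
    unfolding \<psi>_def by auto
  show ?thesis
  proof (rule isomorphicI)
    show "pair_graph T" "pair_graph E" by (rule T.pair_graph_axioms, rule pair_graph_axioms)
    show "bij_betw \<psi> (pverts T) (pverts E)" unfolding \<psi>_def by (rule bij_betw_inv_into[OF bij])
    fix x y assume x: "x \<in> pverts T" and y: "y \<in> pverts T"
    have "gdist T x y = gdist E (\<psi> x) (\<psi> y)"
      using isometry[OF \<psi>(1)[OF x] \<psi>(1)[OF y]] \<psi>(2) x y by simp
    then show "(x, y) \<in> parcs T \<longleftrightarrow> (\<psi> x, \<psi> y) \<in> parcs E"
      using T.gdist_eq_1_iff[OF x y] gdist_eq_1_iff[OF \<psi>(1)[OF x] \<psi>(1)[OF y]] by simp
  qed
qed

lemma total_sum_eq_imp_isomorphic: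
  assumes eq: "(\<Sum>x\<in>pverts T. \<Sum>y\<in>pverts T. f (gdist T x y)) =
      (\<Sum>x\<in>pverts E. \<Sum>y\<in>pverts E. f (gdist E x y))"
  shows "isomorphic T E"
proof -
  have pair_eq: "pair_sum f p q = T.pair_sum f p q" if pq: "p \<le> D" "q \<le> D" for p q
  proof -
    have "(\<Sum>p\<le>D. \<Sum>q\<le>D. pair_sum f p q) = (\<Sum>p\<le>D. \<Sum>q\<le>D. T.pair_sum f p q)"
      using eq unfolding sum_by_levels T.sum_by_levels diam_E T_diam by simp
    then have "(\<Sum>q\<le>D. pair_sum f p q) = (\<Sum>q\<le>D. T.pair_sum f p q)"
      by (rule sum_mono_inv) (auto intro: sum_mono pair_sum_le pq)
    then show ?thesis
      by (rule sum_mono_inv) (auto intro: pair_sum_le pq)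
  qed
  have "T.pair_sum f p q = pair_bound T.diam p q (card (T.level p)) (card (T.level q)) f"
    if pq: "T.diam < 2 * p" "p \<le> q" "q \<le> T.diam" for p q
  proof (rule antisym)
    show "pair_bound T.diam p q (card (T.level p)) (card (T.level q)) f \<le> T.pair_sum f p q"
      by (rule T.pair_sum_ge_bound(1)[OF mono pq])
    show "T.pair_sum f p q \<le> pair_bound T.diam p q (card (T.level p)) (card (T.level q)) f"
      using pair_sum_E_le[OF strict_mono_mono[OF mono], of p q] pair_eq[of p q] pq T_diam T_card_level
      by simp
  qed
  from T.tight_imp_caterpillar[OF mono this] show ?thesis
    using caterpillar_isomorphic eq unfolding T_diam by metis
qed

lemma index_sum_minimal:
  shows "(\<Sum>e\<in>vertex_pairs E. f (pair_dist E e)) \<le> (\<Sum>e\<in>vertex_pairs T. f (pair_dist T e))"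
    and "(\<Sum>e\<in>vertex_pairs T. f (pair_dist T e)) = (\<Sum>e\<in>vertex_pairs E. f (pair_dist E e)) \<Longrightarrow>
      isomorphic T E"
  using total_sum_le total_sum_eq_imp_isomorphic
  unfolding sum_vertex_pairs T.sum_vertex_pairs T_card_verts by simp_all

end

text \<open>
  The multiplicity of the least eccentricity is not given, but the parity of the diameter
  determines it in any tree (\<open>card_central_level\<close>).
\<close>

lemma eccentric_sequence_E:
  assumes G: "tree_graph G" and diam: "tree_metric.diam (pverts G) (gdist G) = D"
    and card: "\<And>p. r < p \<Longrightarrow> p \<le> D \<Longrightarrow>
      card (tree_metric.level (pverts G) (gdist G) p) = ms ! (p - r - 1)"
  shows "eccentric_sequence E = eccentric_sequence G"
proof -
  interpret G: tree_graph G by (rule G)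
  have "count (mset (eccentric_sequence E)) p = count (mset (eccentric_sequence G)) p" for p
  proof -
    have "card (level p) = card (G.level p)"
    proof (cases "D \<le> 2 * p \<and> p \<le> D")
      case False
      then have "level p = {}" "G.level p = {}"
        using level_nonempty_iff[of p] G.level_nonempty_iff[of p] diam_E diam by auto
      then show ?thesis by simp
    next
      case True
      show ?thesis
      proof (cases "r < p")
        case True
        then show ?thesis using card card_level_E \<open>D \<le> 2 * p \<and> p \<le> D\<close> by simp
      next
        case False
        then have "2 * p \<le> D + 1" using len by linarith
        then show ?thesis
          using card_central_level[of p] G.card_central_level[of p] True diam_E diam by simp
      qed
    qed
    then show ?thesis
      using count_eccentric_sequence[of p] G.count_eccentric_sequence[of p] by (simp add: count_mset)
  qed
  then have "mset (eccentric_sequence E) = mset (eccentric_sequence G)" by (rule multiset_eqI)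
  then show ?thesis
    by (simp add: eccentric_sequence_def)
qed

end

section \<open>The four indices\<close>

text \<open>
  Distances never exceed the diameter \<open>n\<close>. The values beyond serve only to make the function strictly
  increasing on all natural numbers.
\<close>

lemma strict_mono_complementary:
  "strict_mono (\<lambda>k. if k \<le> n then 1 / (real n + 1 - real k) else real k + 1)"
  unfolding strict_mono_Suc_iff
proof
  fix k
  consider "Suc k \<le> n" | "k = n" | "n < k" by linarith
  then show "(if k \<le> n then 1 / (real n + 1 - real k) else real k + 1)
      < (if Suc k \<le> n then 1 / (real n + 1 - real (Suc k)) else real (Suc k) + 1)"
    by cases (auto intro!: divide_strict_left_mono mult_pos_pos)
qed

lemma strict_mono_choose_two: "strict_mono (\<lambda>k. real ((1 + k) choose 2))"
  by (simp add: strict_mono_Suc_iff numeral_2_eq_2)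

lemma strict_mono_powr: "0 < a \<Longrightarrow> strict_mono (\<lambda>k. real k powr a)"
  by (simp add: strict_mono_Suc_iff powr_less_mono2)

lemma pair_dist_le_diameter:
  assumes "tree_graph G" "e \<in> vertex_pairs G"
  shows "pair_dist G e \<le> graph_diameter G"
proof -
  interpret tree_graph G by fact
  obtain u v where "e = {u, v}" "u \<in> pverts G" "v \<in> pverts G"
    using assms(2) by (auto simp: vertex_pairs_def card_2_iff)
  then show ?thesis using d_le_diam[of u v] by (simp add: pair_dist_eq graph_diameter_eq)
qed

theorem corollary1:
  fixes S :: "nat list" and r :: nat and ms :: "nat list"
  assumes "tree_eccentric_sequence S"
    and "short_form S = (r, ms)"
  shows "undirected_tree (extremal_tree r ms) \<and>
    eccentric_sequence (extremal_tree r ms) = S \<and>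
    (\<forall>T :: 'a pair_pre_digraph. undirected_tree T \<and> eccentric_sequence T = S \<longrightarrow>
      (wiener (extremal_tree r ms) \<le> wiener T \<and>
        (wiener T = wiener (extremal_tree r ms) \<longrightarrow> isomorphic T (extremal_tree r ms))) \<and>
      (hyper_wiener (extremal_tree r ms) \<le> hyper_wiener T \<and>
        (hyper_wiener T = hyper_wiener (extremal_tree r ms) \<longrightarrow>
          isomorphic T (extremal_tree r ms))) \<and>
      (\<forall>a::real. 0 < a \<longrightarrow>
        generalised_wiener a (extremal_tree r ms) \<le> generalised_wiener a T \<and>
        (generalised_wiener a T = generalised_wiener a (extremal_tree r ms) \<longrightarrow>
          isomorphic T (extremal_tree r ms))) \<and>
      (reciprocal_complementary_wiener (extremal_tree r ms) \<le> reciprocal_complementary_wiener T \<and>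
        (reciprocal_complementary_wiener T =
            reciprocal_complementary_wiener (extremal_tree r ms) \<longrightarrow>
          isomorphic T (extremal_tree r ms))))"
proof -
  obtain G :: "nat pair_pre_digraph" where "undirected_tree G" and S: "eccentric_sequence G = S"
    using assms(1) unfolding tree_eccentric_sequence_def by blast
  then interpret G: tree_graph G by (simp add: undirected_tree_iff_tree_graph)
  have r: "r = (G.diam + 1) div 2"
    and ms: "ms = map (\<lambda>p. card (G.level p)) [(G.diam + 1) div 2 + 1..<G.diam + 1]"
    using assms(2) G.short_form_eccentric_sequence S by simp_all
  have len: "length ms = G.diam - r" unfolding ms r by (simp del: upt_Suc)
  have D: "G.diam = r + length ms" "G.diam \<le> 2 * r" "2 * r \<le> G.diam + 1" using len r by auto
  have nth: "ms ! i = card (G.level (r + 1 + i))" if "i < length ms" for i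
  proof -
    have "i < length [(G.diam + 1) div 2 + 1..<G.diam + 1]" using that unfolding ms by simp
    then show ?thesis unfolding ms r by (simp del: upt_Suc)
  qed
  interpret E: extremal_params r ms
  proof
    show "length ms \<le> r" "r \<le> length ms + 1" using D by auto
    show "2 \<le> ms ! i" if "i < length ms" for i
      using G.two_le_card_level[of "r + 1 + i"] nth[OF that] D that by simp
  qed
  have E_sequence: "eccentric_sequence (extremal_tree r ms) = S"
    unfolding S[symmetric]
  proof (rule E.eccentric_sequence_E[OF G.tree_graph_axioms D(1)])
    fix p assume "r < p" "p \<le> r + length ms"
    then show "card (G.level p) = ms ! (p - r - 1)" using nth[of "p - r - 1"] by simp
  qed
  have minimal: "sum (\<lambda>e. f (pair_dist E.E e)) (vertex_pairs E.E) \<le> sum (\<lambda>e. f (pair_dist T e)) (vertex_pairs T)"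
    and unique: "sum (\<lambda>e. f (pair_dist T e)) (vertex_pairs T) = sum (\<lambda>e. f (pair_dist E.E e)) (vertex_pairs E.E) \<Longrightarrow>
      isomorphic T E.E"
    if "tree_graph T" "eccentric_sequence T = S" "strict_mono f"
    for T :: "'a pair_pre_digraph" and f :: "nat \<Rightarrow> real"
    using E.index_sum_minimal[of T f] that E_sequence by simp_all
  show ?thesis
  proof (intro conjI allI impI)
    show "undirected_tree (extremal_tree r ms)"
      by (simp add: undirected_tree_iff_tree_graph E.tree_graph_axioms)
    show "eccentric_sequence (extremal_tree r ms) = S" by (rule E_sequence)
  next
    fix T :: "'a pair_pre_digraph"
    assume "undirected_tree T \<and> eccentric_sequence T = S"
    then have T: "tree_graph T" "eccentric_sequence T = S" by (simp_all add: undirected_tree_iff_tree_graph)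
    note min = minimal[OF T] and uniq = unique[OF T]
    have id: "strict_mono real" by (simp add: strict_mono_def)
    have real_wiener: "real (wiener H) = (\<Sum>e\<in>vertex_pairs H. real (pair_dist H e))"
      for H :: "'b pair_pre_digraph" by (simp add: wiener_def)
    have real_hyper: "real (hyper_wiener H) = (\<Sum>e\<in>vertex_pairs H. real ((1 + pair_dist H e) choose 2))"
      for H :: "'b pair_pre_digraph" by (simp add: hyper_wiener_def)
    show "wiener E.E \<le> wiener T" using min[OF id] by (simp flip: real_wiener)
    show "isomorphic T E.E" if "wiener T = wiener E.E"
      using uniq[OF id] that by (simp flip: real_wiener)
    show "hyper_wiener E.E \<le> hyper_wiener T"
      using min[OF strict_mono_choose_two] by (simp only: real_hyper[symmetric] of_nat_le_iff)
    show "isomorphic T E.E" if "hyper_wiener T = hyper_wiener E.E"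
      using uniq[OF strict_mono_choose_two] that by (simp only: real_hyper[symmetric])
    show "generalised_wiener a E.E \<le> generalised_wiener a T" if "0 < a" for a
      unfolding generalised_wiener_def by (rule min[OF strict_mono_powr[OF that]])
    show "isomorphic T E.E" if "0 < a" "generalised_wiener a T = generalised_wiener a E.E" for a
      using uniq[OF strict_mono_powr[OF that(1)]] that(2) unfolding generalised_wiener_def .
    interpret T: tree_graph T by (rule T(1))
    define g where "g = (\<lambda>k. if k \<le> G.diam then 1 / (real G.diam + 1 - real k) else real k + 1)"
    have g: "strict_mono g" unfolding g_def by (rule strict_mono_complementary)
    have rcw: "reciprocal_complementary_wiener H = (\<Sum>e\<in>vertex_pairs H. g (pair_dist H e))"
      if H: "tree_graph H" "graph_diameter H = G.diam" for H :: "'b pair_pre_digraph"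
      unfolding reciprocal_complementary_wiener_def g_def
      using pair_dist_le_diameter[OF H(1)] H(2) by (intro sum.cong) auto
    have "graph_diameter T = G.diam" "graph_diameter E.E = G.diam"
      using T.graph_diameter_eq E.graph_diameter_eq T.diam_eq_Max G.diam_eq_Max E.diam_eq_Max T(2) S E_sequence
      by simp_all
    note rcw_TE = rcw[OF T(1) this(1)] rcw[OF E.tree_graph_axioms this(2)]
    show "reciprocal_complementary_wiener E.E \<le> reciprocal_complementary_wiener T"
      unfolding rcw_TE by (rule min[OF g])
    show "isomorphic T E.E" if "reciprocal_complementary_wiener T = reciprocal_complementary_wiener E.E"
      using uniq[OF g] that unfolding rcw_TE .
  qed
qed

end
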